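(* Let $k\ge 2$ be fixed. Asymptotically almost surely (i.e. with probability tending to $1$ as $n\to\infty$), $T\sim\mathcal{R}(n,k)$ has the property that every minimal feedback arc set of $T$ contains $n-k+1$ pairwise vertex-disjoint $k$-cliques.
   Context: $\mathcal{R}(n,k)$ denotes the probability space of $k$-partite tournaments with vertex classes $A_1,\ldots,A_k$, each of size $n$, where every edge between distinct classes is oriented independently and uniformly at random. A feedback arc set of a directed graph $T$ is a set of edges (viewed as a spanning subgraph) meeting every directed cycle; it is minimal if no proper subset of it is a feedback arc set. A $k$-clique in a feedback arc set $H$ is a set of $k$ vertices that are pairwise adjacent in $H$. *)

theory Defs
  imports Complex_Main
begin

text \<open>Vertices of the k-partite tournament: pairs (i, j) with class index i < k
  and position j < n; the vertex class A_i is {i} \<times> {..<n}.\<close>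

definition mp_vertices :: "nat \<Rightarrow> nat \<Rightarrow> (nat \<times> nat) set" where
  "mp_vertices k n = {..<k} \<times> {..<n}"

text \<open>The sample space of R(n,k): all orientations of the complete k-partite graph
  with classes of size n. Each such orientation is equally likely, which is the same
  as orienting every edge independently and uniformly at random.\<close>

definition multipartite_tournaments :: "nat \<Rightarrow> nat \<Rightarrow> (nat \<times> nat) rel set" where
  "multipartite_tournaments k n =
     {T. T \<subseteq> mp_vertices k n \<times> mp_vertices k n
         \<and> (\<forall>(u, v) \<in> T. fst u \<noteq> fst v)
         \<and> (\<forall>u \<in> mp_vertices k n. \<forall>v \<in> mp_vertices k n.
               fst u \<noteq> fst v \<longrightarrow> ((u, v) \<in> T \<longleftrightarrow> (v, u) \<notin> T))}"

definition feedback_arc_set :: "'a rel \<Rightarrow> 'a rel \<Rightarrow> bool" where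
  "feedback_arc_set T H \<longleftrightarrow> H \<subseteq> T \<and> acyclic (T - H)"

definition minimal_feedback_arc_set :: "'a rel \<Rightarrow> 'a rel \<Rightarrow> bool" where
  "minimal_feedback_arc_set T H \<longleftrightarrow>
     feedback_arc_set T H \<and> (\<forall>H'. H' \<subset> H \<longrightarrow> \<not> feedback_arc_set T H')"

definition is_clique :: "'a rel \<Rightarrow> nat \<Rightarrow> 'a set \<Rightarrow> bool" where
  "is_clique H k S \<longleftrightarrow> finite S \<and> card S = k \<and>
     (\<forall>u \<in> S. \<forall>v \<in> S. u \<noteq> v \<longrightarrow> (u, v) \<in> H \<or> (v, u) \<in> H)"

definition has_disjoint_cliques :: "'a rel \<Rightarrow> nat \<Rightarrow> nat \<Rightarrow> bool" where
  "has_disjoint_cliques H k m \<longleftrightarrow>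
     (\<exists>\<C>. finite \<C> \<and> card \<C> = m \<and> (\<forall>S \<in> \<C>. is_clique H k S)
          \<and> (\<forall>S \<in> \<C>. \<forall>S' \<in> \<C>. S \<noteq> S' \<longrightarrow> S \<inter> S' = {}))"

definition good_tournament :: "nat \<Rightarrow> nat \<Rightarrow> (nat \<times> nat) rel \<Rightarrow> bool" where
  "good_tournament k n T \<longleftrightarrow>
     (\<forall>H. minimal_feedback_arc_set T H \<longrightarrow> has_disjoint_cliques H k (n - k + 1))"

end

theory Submission
  imports Defs
begin

text \<open>
  Let \<open>H\<close> be a feedback arc set of \<open>T\<close>, and call two vertices adjacent if an edge of \<open>H\<close> joins them.
  With high probability \<open>T\<close> has no complete bipartite subgraph directed from a set of size \<open>s\<close> to
  another, for a slowly growing \<open>s\<close>; splitting two sets of size \<open>2 * s\<close> in different classes by a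
  topological ordering of the acyclic graph \<open>T - H\<close>, one finds an \<open>H\<close>-edge between them. Moreover
  any two vertices \<open>v, v'\<close> of a class have many common neighbours \<open>y\<close> in every other class with
  \<open>v \<rightarrow> y \<rightarrow> v'\<close>, and many with \<open>v' \<rightarrow> y \<rightarrow> v\<close>; as \<open>H\<close> meets every 4-cycle, at most one vertex of a class
  has low \<open>H\<close>-degree into any given other class. Deleting \<open>k - 1\<close> vertices from each class therefore
  leaves a \<open>k\<close>-partite graph with large minimum degrees and an edge between any two sets of size
  \<open>2 * s\<close>. Such a graph has a perfect tiling by \<open>k\<close>-cliques: a partial tiling is augmented by
  exchanging vertices between an uncovered transversal and \<open>3 ^ k - 1\<close> cliques of the tiling, along a
  pattern in which two rows are subject to at most one adjacency condition.
\<close>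

section \<open>Dense relations\<close>

text \<open>\<open>s\<close> vertices of low degree would together see at most half of
  \<open>B\<close>, and density would fail between them and the at least \<open>s\<close> remaining
  vertices of \<open>B\<close>.\<close>

lemma few_low_degree:
  fixes R :: "'a \<Rightarrow> 'b \<Rightarrow> bool"
  assumes fin: "finite A" "finite B" and s: "s > 0" and B: "card B \<ge> 2 * s"
    and dense: "\<And>X Y. X \<subseteq> A \<Longrightarrow> Y \<subseteq> B \<Longrightarrow> card X \<ge> s \<Longrightarrow> card Y \<ge> s \<Longrightarrow> \<exists>x\<in>X. \<exists>y\<in>Y. R x y"
  shows "card {x\<in>A. card {y\<in>B. R x y} * (2 * s) < card B} < s"
proof (rule ccontr)
  let ?L = "{x\<in>A. card {y\<in>B. R x y} * (2 * s) < card B}"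
  assume "\<not> card ?L < s"
  then obtain X where X: "X \<subseteq> ?L" "card X = s" "finite X"
    by (meson not_less obtain_subset_with_card_n)
  let ?N = "\<Union>x\<in>X. {y\<in>B. R x y}"
  have "card ?N * (2 * s) \<le> (\<Sum>x\<in>X. card {y\<in>B. R x y} * (2 * s))"
    unfolding sum_distrib_right[symmetric] by (intro mult_le_mono1 card_UN_le X(3))
  also have "\<dots> \<le> (\<Sum>x\<in>X. card B)"
    by (intro sum_mono) (use X(1) in auto)
  also have "\<dots> = card B * s" using X(2) by simp
  finally have "2 * card ?N \<le> card B" using s by (simp add: algebra_simps)
  moreover have "card (B - ?N) = card B - card ?N"
    by (rule card_Diff_subset) (use fin(2) X(3) in auto)
  ultimately have "card (B - ?N) \<ge> s" using B by linarith
  then obtain x y where "x \<in> X" "y \<in> B - ?N" "R x y"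
    using dense[of X "B - ?N"] X(1,2) by blast
  then show False by auto
qed

text \<open>Greedy embedding: \<open>f a\<close> is chosen with low degree into no other
  \<open>S b\<close>, so each remaining candidate set shrinks by a factor of at most
  \<open>2 * s\<close>. This happens once per index, whence the exponent \<open>card I\<close>;
  density passes to the smaller sets.\<close>

lemma embed_dense_relations:
  fixes S :: "'i \<Rightarrow> 'a set" and R :: "'i \<Rightarrow> 'i \<Rightarrow> 'a \<Rightarrow> 'a \<Rightarrow> bool"
  assumes "finite I" and "s > 0"
    and sym: "\<And>a b x y. R a b x y \<Longrightarrow> R b a y x"
    and "\<And>a. a \<in> I \<Longrightarrow> finite (S a)"
    and "\<And>a. a \<in> I \<Longrightarrow> card (S a) \<ge> (2 * s) ^ card I"
    and "\<And>a b X Y. a \<in> I \<Longrightarrow> b \<in> I \<Longrightarrow> a \<noteq> b \<Longrightarrow> X \<subseteq> S a \<Longrightarrow> Y \<subseteq> S b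
          \<Longrightarrow> card X \<ge> s \<Longrightarrow> card Y \<ge> s \<Longrightarrow> \<exists>x\<in>X. \<exists>y\<in>Y. R a b x y"
  shows "\<exists>f. (\<forall>a\<in>I. f a \<in> S a) \<and> (\<forall>a\<in>I. \<forall>b\<in>I. a \<noteq> b \<longrightarrow> R a b (f a) (f b))"
  using assms(1,4-6)
proof (induction I arbitrary: S rule: finite_induct)
  case empty
  then show ?case by simp
next
  case (insert a I)
  note fin = insert.prems(1) and big = insert.prems(2) and dense = insert.prems(3)
  define L where "L b = {x\<in>S a. card {y\<in>S b. R a b x y} * (2 * s) < card (S b)}" for b
  have cardI: "card (insert a I) = Suc (card I)" using insert.hyps by simp
  have L: "card (L b) < s" if b: "b \<in> I" for b
    unfolding L_def
  proof (rule few_low_degree)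
    have "card I \<ge> 1" using b insert.hyps(1) by (metis One_nat_def Suc_leI card_gt_0_iff empty_iff)
    then have "(2 * s) ^ 1 \<le> (2 * s) ^ Suc (card I)"
      by (intro power_increasing) (use \<open>s > 0\<close> in auto)
    also have "\<dots> \<le> card (S b)" using big[of b] b unfolding cardI by blast
    finally show "card (S b) \<ge> 2 * s" by simp
    show "\<exists>x\<in>X. \<exists>y\<in>Y. R a b x y"
      if "X \<subseteq> S a" "Y \<subseteq> S b" "card X \<ge> s" "card Y \<ge> s" for X Y
      using dense[of a b X Y] that b insert.hyps(2) by blast
  qed (use fin b \<open>s > 0\<close> in auto)
  \<comment> \<open>Each \<open>b\<close> rules out fewer than \<open>s\<close> choices, so the
    lower bound on \<open>S a\<close> leaves one.\<close>
  have "card (\<Union>b\<in>I. L b) \<le> (\<Sum>b\<in>I. card (L b))"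
    by (rule card_UN_le) (use insert.hyps in auto)
  also have "\<dots> \<le> card I * s"
    using sum_bounded_above[of I "\<lambda>b. card (L b)" s] L by fastforce
  also have "\<dots> < 2 ^ Suc (card I) * s"
    by (rule mult_less_mono1[OF Suc_lessD[OF less_exp] \<open>s > 0\<close>])
  also have "\<dots> \<le> (2 * s) ^ Suc (card I)"
  proof -
    have "s ^ 1 \<le> s ^ Suc (card I)" by (rule power_increasing) (use \<open>s > 0\<close> in auto)
    then show ?thesis by (simp add: power_mult_distrib)
  qed
  also have "\<dots> \<le> card (S a)" using big[of a] cardI by simp
  finally have "card (\<Union>b\<in>I. L b) < card (S a)" .
  then obtain x where x: "x \<in> S a" "\<And>b. b \<in> I \<Longrightarrow> x \<notin> L b"
    using card_mono[of "\<Union>b\<in>I. L b" "S a"] fin[of a] insert.hyps(1)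
    by (fastforce simp: L_def not_less[symmetric])
  define S' where "S' b = {y\<in>S b. R a b x y}" for b
  have "\<exists>f. (\<forall>b\<in>I. f b \<in> S' b) \<and> (\<forall>b\<in>I. \<forall>c\<in>I. b \<noteq> c \<longrightarrow> R b c (f b) (f c))"
  proof (rule insert.IH)
    show "finite (S' b)" if "b \<in> I" for b using fin[of b] that by (simp add: S'_def)
    show "card (S' b) \<ge> (2 * s) ^ card I" if b: "b \<in> I" for b
    proof -
      have "(2 * s) ^ card I * (2 * s) \<le> card (S b)" using big[of b] b cardI by (simp add: mult.commute)
      also have "\<dots> \<le> card (S' b) * (2 * s)" using x(1) x(2)[OF b] by (simp add: L_def S'_def)
      finally show ?thesis using \<open>s > 0\<close> by simp
    qed
    show "\<exists>x\<in>X. \<exists>y\<in>Y. R b c x y" if "b \<in> I" "c \<in> I" "b \<noteq> c" "X \<subseteq> S' b" "Y \<subseteq> S' c"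
      "card X \<ge> s" "card Y \<ge> s" for b c X Y
      by (rule dense) (use that in \<open>auto simp: S'_def\<close>)
  qed
  then obtain f where f: "\<And>b. b \<in> I \<Longrightarrow> f b \<in> S' b"
    "\<And>b c. b \<in> I \<Longrightarrow> c \<in> I \<Longrightarrow> b \<noteq> c \<Longrightarrow> R b c (f b) (f c)" by blast
  have "a \<notin> I" by (rule insert.hyps)
  then show ?case
    using x(1) f sym by (intro exI[of _ "f(a := x)"]) (auto simp: S'_def)
qed

section \<open>Sums of two powers of three\<close>

lemma pow3_sum_eq:
  fixes a b c d :: nat
  assumes "(3::nat) ^ a + 3 ^ b = 3 ^ c + 3 ^ d" "a \<le> b" "c \<le> d"
  shows "a = c \<and> b = d"
proof -
  \<comment> \<open>The larger exponents decide: the left side is at most \<open>2 * 3 ^ b\<close>,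
    which is less than \<open>3 ^ d\<close> if \<open>b < d\<close>.\<close>
  have *: "\<not> b < d" if "(3::nat) ^ a + 3 ^ b = 3 ^ c + 3 ^ d" "a \<le> b" for a b c d :: nat
  proof
    assume "b < d"
    then have "(3::nat) ^ Suc b \<le> 3 ^ d" by (intro power_increasing) auto
    moreover have "(3::nat) ^ a \<le> 3 ^ b" using that(2) by (intro power_increasing) auto
    moreover have "(3::nat) ^ b > 0" "(3::nat)^c > 0" by simp_all
    ultimately show False using that(1) by simp
  qed
  have "b = d" using *[of a b c d] *[of c d a b] assms by linarith
  with assms show ?thesis by simp
qed

text \<open>With entries labelled \<open>a + 3 ^ p\<close>, two rows share a label in at most one
  pair of distinct columns. Subtracting the congruences makes \<open>3 ^ p + 3 ^ q'\<close> and
  \<open>3 ^ q + 3 ^ p'\<close> congruent, hence equal; \<open>p \<noteq> p'\<close> excludes the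
  matching \<open>p = p'\<close>, \<open>q' = q\<close>.\<close>

lemma pow3_sidon:
  fixes a b p p' q q' k :: nat
  assumes "p < k" "p' < k" "q < k" "q' < k" "p \<noteq> p'"
    and 1: "(a + 3 ^ p) mod 3 ^ k = (b + 3 ^ p') mod 3 ^ k"
    and 2: "(a + 3 ^ q) mod 3 ^ k = (b + 3 ^ q') mod 3 ^ k"
  shows "p = q \<and> p' = q'"
proof -
  have "(int a + 3 ^ p) mod 3 ^ k = (int b + 3 ^ p') mod 3 ^ k"
    using arg_cong[OF 1, of int] by (simp add: zmod_int)
  moreover have "(int a + 3 ^ q) mod 3 ^ k = (int b + 3 ^ q') mod 3 ^ k"
    using arg_cong[OF 2, of int] by (simp add: zmod_int)
  ultimately have "(3::int) ^ k dvd (int a + 3 ^ p) - (int b + 3 ^ p')"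
    "(3::int) ^ k dvd (int a + 3 ^ q) - (int b + 3 ^ q')"
    by (simp_all add: mod_eq_dvd_iff)
  then have "(3::int) ^ k dvd ((int a + 3 ^ p) - (int b + 3 ^ p')) - ((int a + 3 ^ q) - (int b + 3 ^ q'))"
    by (rule dvd_diff)
  then have dvd: "(3::int) ^ k dvd (3 ^ p + 3 ^ q') - (3 ^ q + 3 ^ p')"
    by (simp add: algebra_simps)
  have le: "3 * (3::int) ^ r \<le> 3 ^ k" if "r < k" for r
    using power_increasing[of "Suc r" k "3::int"] that by simp
  have pos: "(3::int) ^ r > 0" for r by simp
  \<comment> \<open>Each power is positive and at most a third of \<open>3 ^ k\<close>, so the
    congruence is an equality.\<close>
  have "\<bar>(3 ^ p + 3 ^ q') - (3 ^ q + 3 ^ p')\<bar> < (3::int) ^ k"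
    using le[OF assms(1)] le[OF assms(2)] le[OF assms(3)] le[OF assms(4)]
      pos[of p] pos[of p'] pos[of q] pos[of q'] by linarith
  with dvd have "(3 ^ p + 3 ^ q') - (3 ^ q + 3 ^ p') = (0::int)"
    using dvd_imp_le_int[OF _ dvd] by (cases "(3 ^ p + 3 ^ q') - (3 ^ q + 3 ^ p') = (0::int)") linarith+
  then have "int (3 ^ p + 3 ^ q') = int (3 ^ q + 3 ^ p')" by simp
  then have eq: "(3::nat) ^ p + 3 ^ q' = 3 ^ q + 3 ^ p'" by (simp only: of_nat_eq_iff)
  \<comment> \<open>The four instances cover the possible orders of the exponents within the two
    sums.\<close>
  show ?thesis
    using pow3_sum_eq[of p q' q p'] pow3_sum_eq[of q' p q p'] pow3_sum_eq[of p q' p' q]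
      pow3_sum_eq[of q' p p' q] eq assms(5) by linarith
qed

section \<open>Perfect clique tilings\<close>

text \<open>The bound on \<open>d\<close> pays for embedding \<open>3 ^ k - 1\<close> rows with
  density parameter \<open>2 * s\<close>, and for up to \<open>(2 * s) ^ k\<close> uncovered
  vertices per class.\<close>

locale dense_multipartite =
  fixes V :: "nat \<Rightarrow> 'a set" and E :: "'a \<Rightarrow> 'a \<Rightarrow> bool" and k m s d :: nat
  assumes finite_V: "i < k \<Longrightarrow> finite (V i)"
    and card_V: "i < k \<Longrightarrow> card (V i) = m"
    and E_sym: "E x y \<Longrightarrow> E y x"
    and dense: "\<lbrakk>i < k; j < k; i \<noteq> j; X \<subseteq> V i; Y \<subseteq> V j; card X \<ge> s; card Y \<ge> s\<rbrakk>
      \<Longrightarrow> \<exists>x\<in>X. \<exists>y\<in>Y. E x y"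
    and degree: "\<lbrakk>i < k; j < k; i \<noteq> j; v \<in> V i\<rbrakk> \<Longrightarrow> card {y\<in>V j. E v y} \<ge> d"
    and s_pos: "s > 0"
    and d_le: "d \<le> m"
    and d_large: "(4 * s) ^ 3 ^ k \<le> d"
begin

text \<open>Cliques are rows and classes are columns. Injectivity in each column makes the cliques
  vertex-disjoint once the classes are disjoint.\<close>

definition partial_tiling :: "nat \<Rightarrow> (nat \<Rightarrow> nat \<Rightarrow> 'a) \<Rightarrow> bool" where
  "partial_tiling t Q \<longleftrightarrow>
     (\<forall>b<t. \<forall>i<k. Q b i \<in> V i) \<and>
     (\<forall>i<k. inj_on (\<lambda>b. Q b i) {..<t}) \<and>
     (\<forall>b<t. \<forall>i<k. \<forall>j<k. i \<noteq> j \<longrightarrow> E (Q b i) (Q b j))"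

text \<open>For the phase with many uncovered vertices: one vertex per class is embedded
  greedily.\<close>

lemma clique_in_large_sets:
  assumes "\<And>i. i < k \<Longrightarrow> U i \<subseteq> V i" "\<And>i. i < k \<Longrightarrow> card (U i) \<ge> (2 * s) ^ k"
  shows "\<exists>q. (\<forall>i<k. q i \<in> U i) \<and> (\<forall>i<k. \<forall>j<k. i \<noteq> j \<longrightarrow> E (q i) (q j))"
proof -
  have "\<exists>q. (\<forall>i\<in>{..<k}. q i \<in> U i) \<and> (\<forall>i\<in>{..<k}. \<forall>j\<in>{..<k}. i \<noteq> j \<longrightarrow> E (q i) (q j))"
  proof (rule embed_dense_relations[where s = s and R = "\<lambda>i j. E"])
    show "\<exists>x\<in>X. \<exists>y\<in>Y. E x y"
      if "a \<in> {..<k}" "b \<in> {..<k}" "a \<noteq> b" "X \<subseteq> U a" "Y \<subseteq> U b" "s \<le> card X" "s \<le> card Y"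
      for a b X Y
      using dense[of a b X Y] assms(1) that by blast
    show "finite (U i)" if "i \<in> {..<k}" for i
      using assms(1)[of i] finite_V[of i] that by (auto intro: finite_subset)
  qed (use assms(2) s_pos E_sym in auto)
  then show ?thesis by auto
qed

lemma partial_tiling_extend:
  assumes "partial_tiling t Q"
    and "\<And>i. i < k \<Longrightarrow> q i \<in> V i - (\<lambda>b. Q b i) ` {..<t}"
    and "\<And>i j. i < k \<Longrightarrow> j < k \<Longrightarrow> i \<noteq> j \<Longrightarrow> E (q i) (q j)"
  shows "partial_tiling (Suc t) (Q(t := q))"
proof -
  have *: "q i \<noteq> Q b i" if "i < k" "b < t" for b i
    using assms(2)[of i] that by blast
  show ?thesis
    using assms * *[symmetric] unfolding partial_tiling_def
    by (auto simp: less_Suc_eq lessThan_Suc inj_on_def)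
qed

text \<open>Row \<open>x 0 = t\<close> of \<open>Q\<close> consists of uncovered vertices. Label the entry in row \<open>x a\<close> and column
  \<open>i\<close> by \<open>a + 3 ^ i\<close> modulo \<open>3 ^ k\<close>; the entries with a common label form the new cliques.\<close>

lemma partial_tiling_swap:
  fixes x :: "nat \<Rightarrow> nat"
  assumes V: "\<And>b i. b < Suc t \<Longrightarrow> i < k \<Longrightarrow> Q b i \<in> V i"
    and inj: "\<And>i. i < k \<Longrightarrow> inj_on (\<lambda>b. Q b i) {..<Suc t}"
    and clique: "\<And>b i j. b < t \<Longrightarrow> i < k \<Longrightarrow> j < k \<Longrightarrow> i \<noteq> j \<Longrightarrow> E (Q b i) (Q b j)"
    and x: "x 0 = t" "inj_on x {..<3 ^ k}" "x ` {..<3 ^ k} \<subseteq> {..<Suc t}"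
    and adj: "\<And>a b p q. \<lbrakk>a < 3 ^ k; b < 3 ^ k; a \<noteq> b; p < k; q < k; p \<noteq> q;
        (a + 3 ^ p) mod 3 ^ k = (b + 3 ^ q) mod 3 ^ k\<rbrakk> \<Longrightarrow> E (Q (x a) p) (Q (x b) q)"
  shows "\<exists>Q'. partial_tiling (Suc t) Q'"
proof -
  define M :: nat where "M = 3 ^ k"
  have M: "M > 0" by (simp add: M_def)
  have wM: "3 ^ i < M" if "i < k" for i
    using that unfolding M_def by (intro power_strict_increasing) auto
  \<comment> \<open>\<open>r i a\<close> is the index of the row whose entry in column
    \<open>i\<close> has label \<open>a\<close>. For \<open>i < k\<close> the subtraction does not
    truncate, since \<open>3 ^ i < M\<close>.\<close>
  define r where "r i a = (a + (M - 3 ^ i)) mod M" for i a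
  have r_less: "r i a < M" for i a using M by (simp add: r_def)
  have r_label: "(r i a + 3 ^ i) mod M = a" if "i < k" "a < M" for i a
    using wM[OF that(1)] that(2) by (simp add: r_def mod_simps)
  define y where "y = the_inv_into {..<M} x"
  have y: "y (x a) = a" if "a < M" for a
    using that x(2) by (simp add: y_def the_inv_into_f_f M_def)
  \<comment> \<open>In column \<open>i\<close>, row \<open>x a\<close> receives the entry labelled
    \<open>a\<close>; rows outside the range of \<open>x\<close> are kept. Injectivity of
    \<open>\<sigma> i\<close> keeps the columns of \<open>Q'\<close> injective.\<close>
  define \<sigma> where "\<sigma> i b = (if b \<in> x ` {..<M} then x (r i (y b)) else b)" for i b
  define Q' where "Q' b i = Q (\<sigma> i b) i" for b i
  have \<sigma>_less: "\<sigma> i b < Suc t" if "b < Suc t" for i b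
    using that x(3) r_less by (auto simp: \<sigma>_def M_def)
  have \<sigma>_inj: "inj_on (\<sigma> i) {..<Suc t}" if i: "i < k" for i
  proof (rule inj_onI)
    fix b c assume eq: "\<sigma> i b = \<sigma> i c"
    have in_iff: "\<sigma> i b \<in> x ` {..<M} \<longleftrightarrow> b \<in> x ` {..<M}" for b
      using r_less by (auto simp: \<sigma>_def)
    show "b = c"
    proof (cases "b \<in> x ` {..<M}")
      case False
      then show ?thesis using eq in_iff[of b] in_iff[of c] by (auto simp: \<sigma>_def)
    next
      case True
      then have "c \<in> x ` {..<M}" using eq in_iff by metis
      with True obtain a a' where a: "b = x a" "a < M" "c = x a'" "a' < M" by auto
      then have "x (r i a) = x (r i a')" using eq by (simp add: \<sigma>_def y)
      then have "r i a = r i a'" using x(2) r_less by (auto simp: inj_on_def M_def)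
      then show ?thesis using r_label[OF i] a by metis
    qed
  qed
  have "partial_tiling (Suc t) Q'"
    unfolding partial_tiling_def
  proof (intro conjI allI impI)
    fix b i assume "b < Suc t" "i < k"
    then show "Q' b i \<in> V i" by (simp add: Q'_def V \<sigma>_less)
  next
    fix i assume i: "i < k"
    have "inj_on ((\<lambda>b. Q b i) \<circ> \<sigma> i) {..<Suc t}"
      by (intro comp_inj_on \<sigma>_inj i inj_on_subset[OF inj[OF i]]) (use \<sigma>_less in auto)
    then show "inj_on (\<lambda>b. Q' b i) {..<Suc t}" by (simp add: Q'_def comp_def)
  next
    fix b i j assume b: "b < Suc t" and ij: "i < k" "j < k" "i \<noteq> j"
    show "E (Q' b i) (Q' b j)"
    proof (cases "b \<in> x ` {..<M}")
      case True
      then obtain a where a: "b = x a" "a < M" by auto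
      have lab: "(r i a + 3 ^ i) mod M = (r j a + 3 ^ j) mod M"
        using r_label ij a by simp
      \<comment> \<open>Within one row distinct columns have distinct labels: otherwise the Sidon
        property, applied also to the trivial coincidence of column \<open>i\<close> with itself,
        gives \<open>j = i\<close>.\<close>
      have "r i a \<noteq> r j a"
      proof
        assume "r i a = r j a"
        then show False
          using pow3_sidon[of i k j i i "r i a" "r i a"] lab ij by (simp add: M_def)
      qed
      then have "E (Q (x (r i a)) i) (Q (x (r j a)) j)"
        using adj[of "r i a" "r j a" i j] lab r_less ij by (simp add: M_def)
      then show ?thesis using a by (simp add: Q'_def \<sigma>_def y)
    next
      case False
      \<comment> \<open>An untouched row is an old clique, because the uncovered row
        \<open>t = x 0\<close> is among the exchanged ones.\<close>
      then have "b \<noteq> t" using x(1) M by auto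
      then show ?thesis using False clique[of b i j] b ij by (simp add: Q'_def \<sigma>_def)
    qed
  qed
  then show ?thesis by blast
qed

text \<open>If many vertices are uncovered, they contain a new clique. Otherwise an uncovered
  transversal \<open>u\<close> becomes index 0 of the exchange pattern, and covered rows are
  embedded at the indices \<open>1\<close> to \<open>3 ^ k - 1\<close>. By the Sidon property two
  indices impose at most one adjacency, so degree (towards \<open>u\<close>) and density (elsewhere)
  suffice.\<close>

lemma partial_tiling_augment:
  assumes Q: "partial_tiling t Q" and t: "t < m"
  shows "\<exists>Q'. partial_tiling (Suc t) Q'"
proof -
  define U where "U i = V i - (\<lambda>b. Q b i) ` {..<t}" for i
  have QV: "Q b i \<in> V i" if "b < t" "i < k" for b i using Q that by (simp add: partial_tiling_def)
  have Qinj: "inj_on (\<lambda>b. Q b i) {..<t}" if "i < k" for i using Q that by (simp add: partial_tiling_def)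
  have Qcl: "E (Q b i) (Q b j)" if "b < t" "i < k" "j < k" "i \<noteq> j" for b i j
    using Q that by (simp add: partial_tiling_def)
  have cardU: "card (U i) = m - t" if "i < k" for i
  proof -
    have "card (U i) = card (V i) - card ((\<lambda>b. Q b i) ` {..<t})"
      unfolding U_def by (rule card_Diff_subset) (use QV that in auto)
    then show ?thesis using card_V[OF that] card_image[OF Qinj[OF that]] by simp
  qed
  show ?thesis
  proof (cases "m - t \<ge> (2 * s) ^ k")
    case True
    then obtain q where "\<forall>i<k. q i \<in> U i" "\<forall>i<k. \<forall>j<k. i \<noteq> j \<longrightarrow> E (q i) (q j)"
      using clique_in_large_sets[of U] cardU by (auto simp: U_def)
    then have "partial_tiling (Suc t) (Q(t := q))"
      by (intro partial_tiling_extend Q) (auto simp: U_def)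
    then show ?thesis by blast
  next
    case False
    have "U i \<noteq> {}" if "i < k" for i using cardU[OF that] t by auto
    then have "\<forall>i. \<exists>v. i < k \<longrightarrow> v \<in> U i" by blast
    then obtain u where u: "\<And>i. i < k \<Longrightarrow> u i \<in> U i" by metis
    define M :: nat where "M = 3 ^ k"
    define lab where "lab a p = (a + 3 ^ p) mod M" for a p
    define I where "I = {1..<M}"
    \<comment> \<open>\<open>S a\<close> holds the covered rows that fit index \<open>a\<close> as
      far as \<open>u\<close> is concerned; \<open>R\<close> is compatibility of two covered rows,
      where \<open>x \<noteq> y\<close> keeps the exchanged rows distinct.\<close>
    define S where "S a = {b. b < t \<and> (\<forall>p<k. \<forall>q<k. p \<noteq> q \<longrightarrow> lab 0 p = lab a q \<longrightarrow> E (u p) (Q b q))}" for a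
    define R where "R a b x y \<longleftrightarrow> x \<noteq> y \<and>
      (\<forall>p<k. \<forall>q<k. p \<noteq> q \<longrightarrow> lab a p = lab b q \<longrightarrow> E (Q x p) (Q y q))" for a b x y
    have unique: "p = p' \<and> q = q'"
      if "p < k" "q < k" "p' < k" "q' < k" "p \<noteq> q" "lab a p = lab b q" "lab a p' = lab b q'"
      for a b p q p' q'
      using pow3_sidon[of p k q p' q' a b] that by (simp add: lab_def M_def)
    have kM: "k < M" unfolding M_def using less_exp[of k] power_mono[of 2 "3::nat" k] by linarith
    \<comment> \<open>Here \<open>card I = 3 ^ k - 1\<close>; the one remaining factor
      \<open>4 * s\<close> of the bound on \<open>d\<close> absorbs the summand
      \<open>(2 * s) ^ k\<close>.\<close>
    have large: "(2 * (2 * s)) ^ card I + (2 * s) ^ k \<le> d"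
    proof -
      have "(2 * s) ^ k \<le> (4 * s) ^ k" by (rule power_mono) auto
      also have "\<dots> \<le> (4 * s) ^ (M - 1)"
        by (rule power_increasing) (use kM s_pos in auto)
      finally have "(4 * s) ^ (M - 1) + (2 * s) ^ k \<le> 2 * (4 * s) ^ (M - 1)" by linarith
      also have "\<dots> \<le> (4 * s) * (4 * s) ^ (M - 1)" by (rule mult_le_mono1) (use s_pos in auto)
      also have "\<dots> = (4 * s) ^ M" using kM by (metis gr_implies_not0 power_eq_if)
      also have "\<dots> \<le> d" using d_large by (simp add: M_def)
      finally show ?thesis unfolding I_def mult.assoc[symmetric] by simp
    qed
    have S_large: "(2 * (2 * s)) ^ card I \<le> card (S a)" if "a \<in> I" for a
    proof (cases "\<exists>p<k. \<exists>q<k. p \<noteq> q \<and> lab 0 p = lab a q")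
      case True
      then obtain p q where pq: "p < k" "q < k" "p \<noteq> q" "lab 0 p = lab a q" by blast
      \<comment> \<open>Only one adjacency is imposed, so \<open>S a\<close> collects the rows of
        all covered neighbours of \<open>u p\<close> in column \<open>q\<close>. Fewer than
        \<open>(2 * s) ^ k\<close> of the at least \<open>d\<close> neighbours are
        uncovered.\<close>
      have "S a = {b. b < t \<and> E (u p) (Q b q)}"
        using unique[OF pq(1,2) _ _ pq(3,4)] pq unfolding S_def by blast
      moreover have "{y\<in>V q. E (u p) y} \<subseteq> U q \<union> (\<lambda>b. Q b q) ` {b. b < t \<and> E (u p) (Q b q)}"
        by (auto simp: U_def)
      ultimately have "card {y\<in>V q. E (u p) y} \<le> card (U q \<union> (\<lambda>b. Q b q) ` S a)"
        using finite_V[OF pq(2)] by (intro card_mono) (auto simp: U_def)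
      also have "\<dots> \<le> card (U q) + card ((\<lambda>b. Q b q) ` S a)" by (rule card_Un_le)
      also have "card ((\<lambda>b. Q b q) ` S a) \<le> card (S a)"
        by (rule card_image_le) (simp add: S_def)
      finally have "d \<le> card (U q) + card (S a)"
        using degree[of p q "u p"] u[of p] pq by (auto simp: U_def)
      then show ?thesis using large cardU[OF pq(2)] False by linarith
    next
      case False': False
      \<comment> \<open>Without a condition all \<open>t\<close> rows qualify, and
        \<open>m - t < (2 * s) ^ k\<close>.\<close>
      then have "S a = {..<t}" unfolding S_def by auto
      then show ?thesis using False d_le large t by simp
    qed
    have "\<exists>f. (\<forall>a\<in>I. f a \<in> S a) \<and> (\<forall>a\<in>I. \<forall>b\<in>I. a \<noteq> b \<longrightarrow> R a b (f a) (f b))"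
    proof (rule embed_dense_relations[where s = "2 * s" and R = R])
      show "R b a y x" if "R a b x y" for a b x y using that E_sym unfolding R_def by metis
      show "\<exists>x\<in>X. \<exists>y\<in>Y. R a b x y" if ab: "a \<in> I" "b \<in> I" "a \<noteq> b"
        and XY: "X \<subseteq> S a" "Y \<subseteq> S b" "2 * s \<le> card X" "2 * s \<le> card Y" for a b X Y
      proof -
        \<comment> \<open>The two sets of rows may overlap; \<open>2 * s\<close> rows on each side
          leave \<open>s\<close> on each side that are disjoint.\<close>
        obtain X' where X': "X' \<subseteq> X" "card X' = s" "finite X'"
          using obtain_subset_with_card_n[of s X] XY(3) by auto
        define Y' where "Y' = Y - X'"
        have Y': "card Y' \<ge> s" "Y' \<subseteq> Y" "X' \<inter> Y' = {}"
          using diff_card_le_card_Diff[OF X'(3), of Y] XY(4) X'(2) by (auto simp: Y'_def)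
        have lt: "X' \<subseteq> {..<t}" "Y' \<subseteq> {..<t}" using X'(1) Y'(2) XY(1,2) by (auto simp: S_def)
        show ?thesis
        proof (cases "\<exists>p<k. \<exists>q<k. p \<noteq> q \<and> lab a p = lab b q")
          case True
          then obtain p q where pq: "p < k" "q < k" "p \<noteq> q" "lab a p = lab b q" by blast
          have "\<exists>x\<in>(\<lambda>b. Q b p) ` X'. \<exists>y\<in>(\<lambda>b. Q b q) ` Y'. E x y"
          proof (rule dense[OF pq(1-3)])
            show "card ((\<lambda>b. Q b p) ` X') \<ge> s"
              using card_image[OF inj_on_subset[OF Qinj[OF pq(1)] lt(1)]] X'(2) by simp
            show "card ((\<lambda>b. Q b q) ` Y') \<ge> s"
              using card_image[OF inj_on_subset[OF Qinj[OF pq(2)] lt(2)]] Y'(1) by simp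
          qed (use lt QV pq in auto)
          then obtain x y where xy: "x \<in> X'" "y \<in> Y'" "E (Q x p) (Q y q)" by blast
          then have "R a b x y" unfolding R_def
            using unique[OF pq(1,2) _ _ pq(3,4)] Y'(3) by blast
          then show ?thesis using xy X'(1) Y'(2) by blast
        next
          case False
          have "X' \<noteq> {}" "Y' \<noteq> {}" using X'(2) Y'(1) s_pos by auto
          then obtain x y where xy: "x \<in> X'" "y \<in> Y'" by blast
          then have "R a b x y" using False Y'(3) unfolding R_def by blast
          then show ?thesis using xy X'(1) Y'(2) by blast
        qed
      qed
    qed (use S_large s_pos in \<open>auto simp: I_def S_def\<close>)
    then obtain f where f: "\<And>a. a \<in> I \<Longrightarrow> f a \<in> S a"
      "\<And>a b. a \<in> I \<Longrightarrow> b \<in> I \<Longrightarrow> a \<noteq> b \<Longrightarrow> R a b (f a) (f b)" by blast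
    have f_less: "f a < t" if "a \<in> I" for a using f(1)[OF that] by (simp add: S_def)
    define Qu where "Qu = Q(t := u)"
    define x where "x = f(0 := t)"
    have I_iff: "a \<in> I \<longleftrightarrow> a < M \<and> a \<noteq> 0" for a by (auto simp: I_def)
    show ?thesis
    proof (rule partial_tiling_swap[where Q = Qu and x = x])
      show "Qu b i \<in> V i" if "b < Suc t" "i < k" for b i
        using QV[of b i] u[of i] that by (auto simp: Qu_def U_def less_Suc_eq)
      show "inj_on (\<lambda>b. Qu b i) {..<Suc t}" if i: "i < k" for i
      proof -
        have "\<forall>b<t. u i \<noteq> Q b i" using u[OF i] unfolding U_def by blast
        then show ?thesis
          using Qinj[OF i] by (fastforce simp: Qu_def inj_on_def less_Suc_eq)
      qed
      show "E (Qu b i) (Qu b j)" if "b < t" "i < k" "j < k" "i \<noteq> j" for b i j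
        using Qcl that by (simp add: Qu_def)
      show "x 0 = t" by (simp add: x_def)
      show "inj_on x {..<3 ^ k}"
      proof (rule inj_onI)
        fix a b assume "a \<in> {..<3 ^ k}" "b \<in> {..<3 ^ k}" and eq: "x a = x b"
        then have ab: "a < M" "b < M" by (simp_all add: M_def)
        show "a = b"
          using f(2)[of a b] f_less[of a] f_less[of b] ab eq
          by (cases "a = 0"; cases "b = 0") (auto simp: I_iff x_def R_def)
      qed
      show "x ` {..<3 ^ k} \<subseteq> {..<Suc t}"
        using f_less by (auto simp: x_def I_iff M_def less_Suc_eq)
      show "E (Qu (x a) p) (Qu (x b) q)"
        if ab: "a < 3 ^ k" "b < 3 ^ k" "a \<noteq> b" and pq: "p < k" "q < k" "p \<noteq> q"
          and eq: "(a + 3 ^ p) mod 3 ^ k = (b + 3 ^ q) mod 3 ^ k" for a b p q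
      proof -
        have *: "E (u p) (Q (f b) q)" if "b \<in> I" "p < k" "q < k" "p \<noteq> q" "lab 0 p = lab b q" for b p q
          using f(1)[OF that(1)] that by (simp add: S_def)
        have l: "lab a p = lab b q" using eq by (simp add: lab_def M_def)
        consider "a = 0" "b \<in> I" | "b = 0" "a \<in> I" | "a \<in> I" "b \<in> I"
          using ab by (auto simp: I_iff M_def)
        then show ?thesis
        proof cases
          case 1
          then show ?thesis using *[of b p q] pq l f_less[of b] by (auto simp: Qu_def x_def I_iff)
        next
          case 2
          then show ?thesis using E_sym[OF *[of a q p]] pq l f_less[of a] by (auto simp: Qu_def x_def I_iff)
        next
          case 3
          then show ?thesis using f(2)[OF 3 ab(3)] pq l f_less[of a] f_less[of b]
            by (auto simp: Qu_def x_def I_iff R_def)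
        qed
      qed
    qed
  qed
qed

theorem perfect_tiling: "\<exists>Q. partial_tiling m Q"
proof -
  have "\<exists>Q. partial_tiling t Q" if "t \<le> m" for t
    using that
  proof (induction t)
    case 0
    then show ?case by (simp add: partial_tiling_def)
  next
    case (Suc t)
    then show ?case using partial_tiling_augment by (meson Suc_le_lessD Suc_leD)
  qed
  then show ?thesis by simp
qed

end

section \<open>Counting orientations\<close>

lemma finite_multipartite_tournaments: "finite (multipartite_tournaments k n)"
proof -
  have "multipartite_tournaments k n \<subseteq> Pow (mp_vertices k n \<times> mp_vertices k n)"
    by (auto simp: multipartite_tournaments_def)
  then show ?thesis by (rule finite_subset) (simp add: mp_vertices_def)
qed

text \<open>Toggling both ordered pairs reverses the edge between \<open>u\<close> and
  \<open>v\<close>, as a tournament contains exactly one of them.\<close>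

definition flip :: "'a \<Rightarrow> 'a \<Rightarrow> 'a rel \<Rightarrow> 'a rel" where
  "flip u v T = {e. (e \<in> T) \<noteq> (e = (u, v) \<or> e = (v, u))}"

lemma in_flip_iff: "e \<in> flip u v T \<longleftrightarrow> (e \<in> T) \<noteq> (e = (u, v) \<or> e = (v, u))"
  by (simp add: flip_def)

lemma flip_flip: "flip u v (flip u v T) = T"
  by (auto simp: flip_def)

lemma flip_in_tournaments:
  assumes "T \<in> multipartite_tournaments k n"
    and "u \<in> mp_vertices k n" "v \<in> mp_vertices k n" "fst u \<noteq> fst v"
  shows "flip u v T \<in> multipartite_tournaments k n"
proof -
  have T: "a \<in> mp_vertices k n" "b \<in> mp_vertices k n" "fst a \<noteq> fst b" if "(a, b) \<in> T" for a b
    using assms(1) that unfolding multipartite_tournaments_def by blast+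
  have 1: "a \<in> mp_vertices k n \<and> b \<in> mp_vertices k n \<and> fst a \<noteq> fst b" if "(a, b) \<in> flip u v T" for a b
    using T[of a b] that assms(2-4) unfolding in_flip_iff by (cases "(a, b) \<in> T") auto
  have 2: "(a, b) \<in> flip u v T \<longleftrightarrow> (b, a) \<notin> flip u v T"
    if "a \<in> mp_vertices k n" "b \<in> mp_vertices k n" "fst a \<noteq> fst b" for a b
  proof -
    have "(a, b) \<in> T \<longleftrightarrow> (b, a) \<notin> T"
      using assms(1) that unfolding multipartite_tournaments_def by blast
    then show ?thesis unfolding in_flip_iff by blast
  qed
  show ?thesis
    unfolding multipartite_tournaments_def mem_Collect_eq
  proof (intro conjI ballI impI)
    show "flip u v T \<subseteq> mp_vertices k n \<times> mp_vertices k n" using 1 by auto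
    show "case e of (u, v) \<Rightarrow> fst u \<noteq> fst v" if "e \<in> flip u v T" for e
      using 1[of "fst e" "snd e"] that by (simp add: split_beta)
  qed (rule 2)
qed

text \<open>Counting form of independence: a family closed under reversing an edge does not depend
  on that edge, and the reversal pairs its members of the two orientations.\<close>

lemma card_flip_closed:
  assumes "\<A> \<subseteq> multipartite_tournaments k n" and closed: "\<And>T. T \<in> \<A> \<Longrightarrow> flip u v T \<in> \<A>"
    and uv: "u \<in> mp_vertices k n" "v \<in> mp_vertices k n" "fst u \<noteq> fst v"
  shows "2 * card {T\<in>\<A>. (u, v) \<in> T} = card \<A>"
proof -
  have fin: "finite \<A>" using assms(1) finite_multipartite_tournaments finite_subset by blast
  have one: "(u, v) \<in> T \<longleftrightarrow> (v, u) \<notin> T" if "T \<in> \<A>" for T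
    using that assms(1) uv unfolding multipartite_tournaments_def by blast
  have "bij_betw (flip u v) {T\<in>\<A>. (u, v) \<in> T} {T\<in>\<A>. (u, v) \<notin> T}"
    by (rule bij_betw_byWitness[where f' = "flip u v"])
      (use closed one in \<open>auto simp: flip_flip in_flip_iff\<close>)
  then have "card {T\<in>\<A>. (u, v) \<notin> T} = card {T\<in>\<A>. (u, v) \<in> T}"
    by (simp add: bij_betw_same_card)
  moreover have "card \<A> = card {T\<in>\<A>. (u, v) \<in> T} + card {T\<in>\<A>. (u, v) \<notin> T}"
    by (subst card_Un_disjoint[symmetric]) (use fin in \<open>auto intro: arg_cong[where f = card]\<close>)
  ultimately show ?thesis by simp
qed

text \<open>Prescribing the edges one at a time halves the family each time.\<close>

lemma card_tournaments_biclique: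
  assumes "i < k" "j < k" "i \<noteq> j" "X \<subseteq> {..<n}" "Y \<subseteq> {..<n}"
  shows "2 ^ (card X * card Y) * card {T \<in> multipartite_tournaments k n. ({i} \<times> X) \<times> ({j} \<times> Y) \<subseteq> T}
    = card (multipartite_tournaments k n)"
proof -
  have "2 ^ card F * card {T \<in> multipartite_tournaments k n. F \<subseteq> T} = card (multipartite_tournaments k n)"
    if "F \<subseteq> ({i} \<times> X) \<times> ({j} \<times> Y)" "finite F" for F
    using that(2,1)
  proof (induction F rule: finite_induct)
    case empty
    then show ?case by simp
  next
    case (insert e F)
    obtain u v where e: "e = (u, v)" by (cases e)
    have uv: "fst u = i" "fst v = j" "u \<in> mp_vertices k n" "v \<in> mp_vertices k n"
      using insert.prems assms e by (auto simp: mp_vertices_def)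
    let ?A = "{T \<in> multipartite_tournaments k n. F \<subseteq> T}"
    have "2 * card {T\<in>?A. (u, v) \<in> T} = card ?A"
    proof (rule card_flip_closed)
      fix T assume T: "T \<in> ?A"
      \<comment> \<open>All pairs in \<open>F\<close> lead from class \<open>i\<close> to class
        \<open>j\<close>, so the reversal destroys none of them.\<close>
      have "(v, u) \<notin> F" using insert.prems uv(1) assms(3) by auto
      then have "F \<subseteq> flip u v T" using T insert.hyps(2) e by (auto simp: in_flip_iff)
      then show "flip u v T \<in> ?A" using T flip_in_tournaments uv assms(3) by simp
    qed (use uv assms(3) in auto)
    moreover have "{T\<in>?A. (u, v) \<in> T} = {T \<in> multipartite_tournaments k n. insert e F \<subseteq> T}"
      using e by auto
    ultimately have *: "card ?A = 2 * card {T \<in> multipartite_tournaments k n. insert e F \<subseteq> T}"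
      by simp
    have "2 ^ card F * card ?A = card (multipartite_tournaments k n)"
      using insert.IH insert.prems by blast
    then show ?case using insert.hyps unfolding * by (simp add: mult.left_commute)
  qed
  from this[of "({i} \<times> X) \<times> ({j} \<times> Y)"] show ?thesis
    using assms(4,5) by (simp add: card_cartesian_product finite_subset)
qed

text \<open>Each \<open>y\<close> is the middle of a path from \<open>(i, b)\<close> to
  \<open>(i, a)\<close> with probability 1/4, and distinct \<open>y\<close> involve distinct edges.
  Two halvings give the quarter that is removed in each induction step.\<close>

lemma card_tournaments_no_path:
  assumes "i < k" "j < k" "i \<noteq> j" "a < n" "b < n" "a \<noteq> b" "finite B" "B \<subseteq> {..<n}"
  shows "4 ^ card B * card {T \<in> multipartite_tournaments k n.
            \<forall>y\<in>B. \<not> (((i, b), (j, y)) \<in> T \<and> ((j, y), (i, a)) \<in> T)}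
    = 3 ^ card B * card (multipartite_tournaments k n)"
  using assms(7,8)
proof (induction B rule: finite_induct)
  case empty
  then show ?case by simp
next
  case (insert y B)
  define \<A> where "\<A> = {T \<in> multipartite_tournaments k n.
      \<forall>y\<in>B. \<not> (((i, b), (j, y)) \<in> T \<and> ((j, y), (i, a)) \<in> T)}"
  define \<P> where "\<P> = {T\<in>{T\<in>\<A>. ((i, b), (j, y)) \<in> T}. ((j, y), (i, a)) \<in> T}"
  have V: "(i, b) \<in> mp_vertices k n" "(i, a) \<in> mp_vertices k n" "(j, y) \<in> mp_vertices k n"
    using assms insert.prems by (auto simp: mp_vertices_def)
  have 1: "2 * card {T\<in>\<A>. ((i, b), (j, y)) \<in> T} = card \<A>"
    by (rule card_flip_closed)
      (use V assms(3) insert.hyps(2) in \<open>auto simp: \<A>_def in_flip_iff intro!: flip_in_tournaments\<close>)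
  \<comment> \<open>As \<open>a \<noteq> b\<close>, reversing the second edge of the path does not
    touch the first, already fixed one.\<close>
  have 2: "2 * card \<P> = card {T\<in>\<A>. ((i, b), (j, y)) \<in> T}"
    unfolding \<P>_def by (rule card_flip_closed)
      (use V assms(3,6) insert.hyps(2) in \<open>auto simp: \<A>_def in_flip_iff intro!: flip_in_tournaments\<close>)
  have fin: "finite \<A>" using finite_multipartite_tournaments by (simp add: \<A>_def)
  have "{T \<in> multipartite_tournaments k n.
      \<forall>y\<in>insert y B. \<not> (((i, b), (j, y)) \<in> T \<and> ((j, y), (i, a)) \<in> T)} = \<A> - \<P>"
    by (auto simp: \<A>_def \<P>_def)
  moreover have "card (\<A> - \<P>) = card \<A> - card \<P>"
    by (rule card_Diff_subset) (use fin in \<open>auto simp: \<P>_def\<close>)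
  then have "4 * card (\<A> - \<P>) = 3 * card \<A>" using 1 2 by simp
  moreover have "4 ^ card B * card \<A> = 3 ^ card B * card (multipartite_tournaments k n)"
    using insert by (simp add: \<A>_def)
  moreover have "4 ^ card (insert y B) * x = 4 ^ card B * (4 * x)"
    "3 ^ card (insert y B) * x = 3 * (3 ^ card B * x)" for x :: nat
    using insert.hyps by simp_all
  ultimately show ?case by (metis mult.left_commute)
qed

section \<open>Union bounds for the two exceptional events\<close>

definition no_biclique :: "nat \<Rightarrow> nat \<Rightarrow> nat \<Rightarrow> (nat \<times> nat) rel \<Rightarrow> bool" where
  "no_biclique k n s T \<longleftrightarrow> (\<forall>i<k. \<forall>j<k. \<forall>X Y. i \<noteq> j \<longrightarrow> X \<subseteq> {..<n} \<longrightarrow> Y \<subseteq> {..<n} \<longrightarrow>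
     card X = s \<longrightarrow> card Y = s \<longrightarrow> \<not> ({i} \<times> X) \<times> ({j} \<times> Y) \<subseteq> T)"

text \<open>The first \<open>r * s\<close> positions of class \<open>j\<close> are cut into
  \<open>r\<close> blocks of length \<open>s\<close>. One path per block yields \<open>r\<close>
  distinct midpoints, and a union bound over blocks replaces a concentration inequality. Both
  directions are covered, as \<open>a\<close> and \<open>b\<close> may be exchanged.\<close>

definition block_paths :: "nat \<Rightarrow> nat \<Rightarrow> nat \<Rightarrow> nat \<Rightarrow> (nat \<times> nat) rel \<Rightarrow> bool" where
  "block_paths k n s r T \<longleftrightarrow> (\<forall>i<k. \<forall>j<k. \<forall>a<n. \<forall>b<n. \<forall>c<r. i \<noteq> j \<longrightarrow> a \<noteq> b \<longrightarrow>
     (\<exists>y\<in>{c * s..<c * s + s}. ((i, b), (j, y)) \<in> T \<and> ((j, y), (i, a)) \<in> T))"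

text \<open>Union bound over \<open>k ^ 2\<close> pairs of classes and at most
  \<open>n ^ (2 * s)\<close> pairs of \<open>s\<close>-sets, each of probability at most
  \<open>1 / 2 ^ (s * s)\<close>.\<close>

lemma card_not_no_biclique:
  "real (card {T \<in> multipartite_tournaments k n. \<not> no_biclique k n s T})
     \<le> real k ^ 2 * real n ^ (2 * s) / 2 ^ (s * s) * real (card (multipartite_tournaments k n))"
proof -
  let ?mt = "multipartite_tournaments k n"
  define P where "P = {X. X \<subseteq> {..<n} \<and> card X = s}"
  \<comment> \<open>With \<open>i \<noteq> j\<close> inside the event the index set is a plain
    product; events with \<open>i = j\<close> are empty.\<close>
  define ev where "ev = (\<lambda>(i, j, X, Y). {T \<in> ?mt. i \<noteq> j \<and> ({i} \<times> X) \<times> ({j} \<times> Y) \<subseteq> T})"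
  let ?I = "{..<k} \<times> {..<k} \<times> P \<times> P"
  have finP: "finite P" by (simp add: P_def)
  have cardP: "card P \<le> n ^ s"
  proof -
    have "card P = n choose s" using n_subsets[of "{..<n}" s] by (simp add: P_def)
    then show ?thesis
      by (metis binomial_eq_0 binomial_le_pow le0 not_less)
  qed
  have ev: "real (card (ev x)) \<le> real (card ?mt) / 2 ^ (s * s)" if "x \<in> ?I" for x
  proof -
    obtain i j X Y where x: "x = (i, j, X, Y)" by (cases x)
    show ?thesis
    proof (cases "i = j")
      case False
      have "2 ^ (s * s) * card (ev x) = card ?mt"
        using card_tournaments_biclique[of i k j X n Y] that False by (simp add: x ev_def P_def)
      then have "2 ^ (s * s) * real (card (ev x)) = real (card ?mt)"
        by (metis of_nat_mult of_nat_numeral of_nat_power)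
      then show ?thesis by (simp add: field_simps)
    qed (simp add: x ev_def)
  qed
  have "card {T \<in> ?mt. \<not> no_biclique k n s T} \<le> card (\<Union>x\<in>?I. ev x)"
  proof (rule card_mono)
    show "finite (\<Union>x\<in>?I. ev x)"
      using finP finite_multipartite_tournaments by (auto simp: ev_def)
    show "{T \<in> ?mt. \<not> no_biclique k n s T} \<subseteq> (\<Union>x\<in>?I. ev x)"
    proof
      fix T assume T: "T \<in> {T \<in> ?mt. \<not> no_biclique k n s T}"
      then obtain i j X Y where "i < k" "j < k" "i \<noteq> j" "X \<subseteq> {..<n}" "Y \<subseteq> {..<n}"
        "card X = s" "card Y = s" "({i} \<times> X) \<times> ({j} \<times> Y) \<subseteq> T"
        unfolding no_biclique_def mem_Collect_eq by blast
      then have "(i, j, X, Y) \<in> ?I" "T \<in> ev (i, j, X, Y)" using T by (simp_all add: P_def ev_def)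
      then show "T \<in> (\<Union>x\<in>?I. ev x)" by blast
    qed
  qed
  also have "\<dots> \<le> (\<Sum>x\<in>?I. card (ev x))" by (rule card_UN_le) (use finP in auto)
  finally have "real (card {T \<in> ?mt. \<not> no_biclique k n s T}) \<le> (\<Sum>x\<in>?I. real (card (ev x)))"
    unfolding of_nat_sum[symmetric] of_nat_le_iff .
  also have "\<dots> \<le> (\<Sum>x\<in>?I. real (card ?mt) / 2 ^ (s * s))" by (intro sum_mono ev)
  also have "\<dots> = real (k * (k * (card P * card P))) * (real (card ?mt) / 2 ^ (s * s))"
    by (simp add: card_cartesian_product)
  also have "\<dots> \<le> real (k * (k * (n ^ s * n ^ s))) * (real (card ?mt) / 2 ^ (s * s))"
    using cardP by (intro mult_right_mono of_nat_mono mult_le_mono) auto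
  also have "\<dots> = real k ^ 2 * real n ^ (2 * s) / 2 ^ (s * s) * real (card ?mt)"
    by (simp add: power2_eq_square power_add mult_2)
  finally show ?thesis .
qed

text \<open>Union bound over classes, endpoints and blocks. The hypothesis keeps every block inside
  its class.\<close>

lemma card_not_block_paths:
  assumes "r * s \<le> n"
  shows "real (card {T \<in> multipartite_tournaments k n. \<not> block_paths k n s r T})
     \<le> real k ^ 2 * real n ^ 2 * real r * (3 / 4) ^ s * real (card (multipartite_tournaments k n))"
proof -
  let ?mt = "multipartite_tournaments k n"
  define ev where "ev = (\<lambda>(i, j, a, b, c). {T \<in> ?mt. i \<noteq> j \<and> a \<noteq> b \<and>
     (\<forall>y\<in>{c * s..<c * s + s}. \<not> (((i, b), (j, y)) \<in> T \<and> ((j, y), (i, a)) \<in> T))})"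
  let ?I = "{..<k} \<times> {..<k} \<times> {..<n} \<times> {..<n} \<times> {..<r}"
  have ev: "real (card (ev x)) \<le> (3 / 4) ^ s * real (card ?mt)" if "x \<in> ?I" for x
  proof -
    obtain i j a b c where x: "x = (i, j, a, b, c)" by (cases x)
    show ?thesis
    proof (cases "i = j \<or> a = b")
      case False
      have "Suc c * s \<le> r * s" using that x by (intro mult_le_mono1) auto
      then have "{c * s..<c * s + s} \<subseteq> {..<n}" using assms by auto
      then have "4 ^ s * card (ev x) = 3 ^ s * card ?mt"
        using card_tournaments_no_path[of i k j a n b "{c * s..<c * s + s}"] that False
        by (simp add: x ev_def)
      then have "4 ^ s * real (card (ev x)) = 3 ^ s * real (card ?mt)"
        by (metis of_nat_mult of_nat_numeral of_nat_power)
      then show ?thesis by (simp add: field_simps)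
    qed (auto simp: x ev_def)
  qed
  have "card {T \<in> ?mt. \<not> block_paths k n s r T} \<le> card (\<Union>x\<in>?I. ev x)"
  proof (rule card_mono)
    show "finite (\<Union>x\<in>?I. ev x)"
      using finite_multipartite_tournaments by (auto simp: ev_def)
    show "{T \<in> ?mt. \<not> block_paths k n s r T} \<subseteq> (\<Union>x\<in>?I. ev x)"
    proof
      fix T assume T: "T \<in> {T \<in> ?mt. \<not> block_paths k n s r T}"
      then obtain i j a b c where "i < k" "j < k" "a < n" "b < n" "c < r" "i \<noteq> j" "a \<noteq> b"
        "\<forall>y\<in>{c * s..<c * s + s}. \<not> (((i, b), (j, y)) \<in> T \<and> ((j, y), (i, a)) \<in> T)"
        unfolding block_paths_def mem_Collect_eq by blast
      then have "(i, j, a, b, c) \<in> ?I" "T \<in> ev (i, j, a, b, c)" using T by (simp_all add: ev_def)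
      then show "T \<in> (\<Union>x\<in>?I. ev x)" by blast
    qed
  qed
  also have "\<dots> \<le> (\<Sum>x\<in>?I. card (ev x))" by (rule card_UN_le) auto
  finally have "real (card {T \<in> ?mt. \<not> block_paths k n s r T}) \<le> (\<Sum>x\<in>?I. real (card (ev x)))"
    unfolding of_nat_sum[symmetric] of_nat_le_iff .
  also have "\<dots> \<le> (\<Sum>x\<in>?I. (3 / 4) ^ s * real (card ?mt))" by (intro sum_mono ev)
  also have "\<dots> = real k ^ 2 * real n ^ 2 * real r * (3 / 4) ^ s * real (card ?mt)"
    by (simp add: card_cartesian_product power2_eq_square)
  finally show ?thesis .
qed

section \<open>Feedback arc sets\<close>

text \<open>Because \<open>f\<close> may have ties, a threshold need not cut off exactly
  \<open>s\<close> elements; the least ones are taken one at a time.\<close>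

lemma exists_lowest_subset:
  fixes f :: "'a \<Rightarrow> nat"
  assumes "finite X" "s \<le> card X"
  shows "\<exists>X'\<subseteq>X. card X' = s \<and> (\<forall>a\<in>X'. \<forall>b\<in>X - X'. f a \<le> f b)"
  using assms(2)
proof (induction s)
  case 0
  then show ?case by (intro exI[of _ "{}"]) auto
next
  case (Suc s)
  then obtain X' where X': "X' \<subseteq> X" "card X' = s" "\<forall>a\<in>X'. \<forall>b\<in>X - X'. f a \<le> f b" by auto
  have "X - X' \<noteq> {}" using X'(1,2) Suc.prems by auto
  then obtain c where c: "c \<in> X - X'" "\<And>b. b \<in> X - X' \<Longrightarrow> f c \<le> f b"
    using ex_has_least_nat[of "\<lambda>c. c \<in> X - X'" _ f] by blast
  have "finite X'" using X'(1) assms(1) finite_subset by blast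
  then have "card (insert c X') = Suc s" using c(1) X'(2) by simp
  moreover have "\<forall>a\<in>insert c X'. \<forall>b\<in>X - insert c X'. f a \<le> f b" using X'(3) c(2) by blast
  ultimately show ?case using X'(1) c(1) by (intro exI[of _ "insert c X'"]) auto
qed

text \<open>Compare the maxima of \<open>f\<close> on the lowest \<open>s\<close> elements of
  \<open>X\<close> and of \<open>Y\<close>. The lowest part with the smaller maximum lies entirely
  below the rest of the other set, which still has \<open>s\<close> elements.\<close>

lemma exists_separated_subsets:
  fixes f :: "'a \<Rightarrow> nat"
  assumes "finite X" "finite Y" "s > 0" "2 * s \<le> card X" "2 * s \<le> card Y"
    and ne: "\<And>x y. x \<in> X \<Longrightarrow> y \<in> Y \<Longrightarrow> f x \<noteq> f y"
  shows "\<exists>X'\<subseteq>X. \<exists>Y'\<subseteq>Y. card X' = s \<and> card Y' = s \<and>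
    ((\<forall>x\<in>X'. \<forall>y\<in>Y'. f x < f y) \<or> (\<forall>x\<in>X'. \<forall>y\<in>Y'. f y < f x))"
proof -
  have main: "\<exists>X'\<subseteq>X. \<exists>Y'\<subseteq>Y. card X' = s \<and> card Y' = s \<and> (\<forall>x\<in>X'. \<forall>y\<in>Y'. f x < f y)"
    if fin: "finite X" "finite Y" and Y: "2 * s \<le> card Y"
      and X0: "X0 \<subseteq> X" "card X0 = s" and x: "\<forall>a\<in>X0. f a \<le> f x"
      and Y0: "Y0 \<subseteq> Y" "card Y0 = s" "\<forall>a\<in>Y0. \<forall>b\<in>Y - Y0. f a \<le> f b" and y: "y \<in> Y0"
      and less: "f x < f y" for X Y X0 Y0 x y
  proof -
    have "card (Y - Y0) = card Y - card Y0" using Y0(1) fin(2) by (meson card_Diff_subset finite_subset)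
    then have "s \<le> card (Y - Y0)" using Y Y0(2) by simp
    then obtain Y' where Y': "Y' \<subseteq> Y - Y0" "card Y' = s" by (meson obtain_subset_with_card_n)
    have "f a < f b" if "a \<in> X0" "b \<in> Y'" for a b
    proof -
      have "f a \<le> f x" using x that by blast
      also note less
      also have "f y \<le> f b" using Y0(3) y Y'(1) that by blast
      finally show ?thesis .
    qed
    then show ?thesis using X0 Y' by (intro exI[of _ X0] exI[of _ Y'] conjI) auto
  qed
  have "s \<le> card X" "s \<le> card Y" using assms(4,5) by auto
  then obtain X0 Y0 where X0: "X0 \<subseteq> X" "card X0 = s" "\<forall>a\<in>X0. \<forall>b\<in>X - X0. f a \<le> f b"
    and Y0: "Y0 \<subseteq> Y" "card Y0 = s" "\<forall>a\<in>Y0. \<forall>b\<in>Y - Y0. f a \<le> f b"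
    using exists_lowest_subset[OF assms(1), of s f] exists_lowest_subset[OF assms(2), of s f] by blast
  have top: "\<exists>x\<in>Z. \<forall>a\<in>Z. f a \<le> f x" if "card Z = s" for Z
  proof -
    have "finite Z" "Z \<noteq> {}" using that \<open>s > 0\<close> by (auto intro: card_ge_0_finite)
    then have "Max (f ` Z) \<in> f ` Z" by simp
    then obtain x where "x \<in> Z" "f x = Max (f ` Z)" by auto
    then show ?thesis using \<open>finite Z\<close> by (auto intro!: bexI[of _ x])
  qed
  obtain x y where x: "x \<in> X0" "\<forall>a\<in>X0. f a \<le> f x" and y: "y \<in> Y0" "\<forall>a\<in>Y0. f a \<le> f y"
    using top[OF X0(2)] top[OF Y0(2)] by blast
  consider "f x < f y" | "f y < f x" using ne[of x y] x(1) y(1) X0(1) Y0(1) by fastforce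
  then show ?thesis
  proof cases
    case 1
    show ?thesis
      using main[OF assms(1,2,5) X0(1,2) x(2) Y0 y(1) 1] by blast
  next
    case 2
    obtain Y' X' where "Y' \<subseteq> Y" "X' \<subseteq> X" "card Y' = s" "card X' = s" "\<forall>y\<in>Y'. \<forall>x\<in>X'. f y < f x"
      using main[OF assms(2,1,4) Y0(1,2) y(2) X0 x(1) 2] by blast
    then show ?thesis by (intro exI[of _ X'] exI[of _ Y'] conjI) auto
  qed
qed

text \<open>The number of ancestors is thus a topological order of \<open>r\<close>:
  \<open>v\<close> inherits all ancestors of \<open>u\<close> and gains \<open>u\<close>
  itself.\<close>

lemma card_trancl_predecessors_less:
  assumes "finite r" "acyclic r" "(u, v) \<in> r"
  shows "card {w. (w, u) \<in> r\<^sup>+} < card {w. (w, v) \<in> r\<^sup>+}"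
proof (rule psubset_card_mono)
  have "{w. (w, v) \<in> r\<^sup>+} \<subseteq> Domain (r\<^sup>+)" by blast
  then show "finite {w. (w, v) \<in> r\<^sup>+}"
    by (rule finite_subset) (simp add: trancl_domain finite_Domain assms(1))
  have "{w. (w, u) \<in> r\<^sup>+} \<subseteq> {w. (w, v) \<in> r\<^sup>+}"
    using assms(3) by (auto intro: trancl_into_trancl)
  moreover have "u \<in> {w. (w, v) \<in> r\<^sup>+}" "u \<notin> {w. (w, u) \<in> r\<^sup>+}"
    using assms(2,3) by (auto simp: acyclic_def)
  ultimately show "{w. (w, u) \<in> r\<^sup>+} \<subset> {w. (w, v) \<in> r\<^sup>+}" by blast
qed

section \<open>Adjacency through a feedback arc set\<close>

locale tournament_fas =
  fixes k n :: nat and T H :: "(nat \<times> nat) rel"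
  assumes T: "T \<in> multipartite_tournaments k n"
    and H: "feedback_arc_set T H"
begin

definition adj :: "nat \<times> nat \<Rightarrow> nat \<times> nat \<Rightarrow> bool" where
  "adj u v \<longleftrightarrow> (u, v) \<in> H \<or> (v, u) \<in> H"

lemma adj_sym: "adj u v \<Longrightarrow> adj v u"
  by (auto simp: adj_def)

lemma finite_T: "finite T"
proof -
  have "T \<subseteq> mp_vertices k n \<times> mp_vertices k n" using T by (simp add: multipartite_tournaments_def)
  then show ?thesis by (rule finite_subset) (simp add: mp_vertices_def)
qed

lemma T_total:
  assumes "i < k" "j < k" "i \<noteq> j" "a < n" "b < n"
  shows "((i, a), (j, b)) \<in> T \<or> ((j, b), (i, a)) \<in> T"
proof -
  have "(i, a) \<in> mp_vertices k n" "(j, b) \<in> mp_vertices k n" "fst (i, a) \<noteq> fst (j, b)"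
    using assms by (simp_all add: mp_vertices_def)
  then show ?thesis using T unfolding multipartite_tournaments_def by blast
qed

text \<open>Otherwise all edges of \<open>T\<close> between \<open>X\<close> and \<open>Y\<close>
  lie in \<open>T - H\<close>. Its topological order separates \<open>s\<close>-subsets, between
  which all edges then point the same way: a forbidden biclique.\<close>

lemma adj_dense:
  assumes nb: "no_biclique k n s T" and s: "s > 0" and ij: "i < k" "j < k" "i \<noteq> j"
    and XY: "X \<subseteq> {i} \<times> {..<n}" "Y \<subseteq> {j} \<times> {..<n}" "2 * s \<le> card X" "2 * s \<le> card Y"
  shows "\<exists>x\<in>X. \<exists>y\<in>Y. adj x y"
proof (rule ccontr)
  assume no: "\<not> (\<exists>x\<in>X. \<exists>y\<in>Y. adj x y)"
  define f where "f u = card {w. (w, u) \<in> (T - H)\<^sup>+}" for u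
  have f: "f u < f v" if "(u, v) \<in> T - H" for u v
    unfolding f_def by (rule card_trancl_predecessors_less)
      (use that H finite_T in \<open>auto simp: feedback_arc_set_def\<close>)
  have fin: "finite X" "finite Y" using XY(1,2) finite_subset by blast+
  have tot: "(x, y) \<in> T - H \<or> (y, x) \<in> T - H" if "x \<in> X" "y \<in> Y" for x y
  proof -
    have "\<not> adj x y" using no that by blast
    moreover have "(x, y) \<in> T \<or> (y, x) \<in> T"
    proof -
      have "x \<in> {i} \<times> {..<n}" "y \<in> {j} \<times> {..<n}" using that XY(1,2) by blast+
      then obtain a b where "x = (i, a)" "y = (j, b)" "a < n" "b < n" by auto
      then show ?thesis using T_total[OF ij] by simp
    qed
    ultimately show ?thesis by (auto simp: adj_def)
  qed
  have "f x \<noteq> f y" if "x \<in> X" "y \<in> Y" for x y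
    using tot[OF that] f by fastforce
  then obtain X' Y' where X': "X' \<subseteq> X" "card X' = s" and Y': "Y' \<subseteq> Y" "card Y' = s"
    and sep: "(\<forall>x\<in>X'. \<forall>y\<in>Y'. f x < f y) \<or> (\<forall>x\<in>X'. \<forall>y\<in>Y'. f y < f x)"
    using exists_separated_subsets[OF fin s XY(3,4), of f] by blast
  have slices: "X' = {i} \<times> snd ` X'" "Y' = {j} \<times> snd ` Y'"
    using X'(1) Y'(1) XY(1,2) by force+
  have snd: "snd ` X' \<subseteq> {..<n}" "snd ` Y' \<subseteq> {..<n}"
    using X'(1) Y'(1) XY(1,2) by auto
  have card: "card (snd ` X') = s" "card (snd ` Y') = s"
    using slices X'(2) Y'(2) by (metis card_cartesian_product_singleton)+
  from sep show False
  proof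
    assume "\<forall>x\<in>X'. \<forall>y\<in>Y'. f x < f y"
    then have "(x, y) \<in> T" if "x \<in> X'" "y \<in> Y'" for x y
      using tot[of x y] f[of y x] that X'(1) Y'(1) by (meson Diff_iff less_asym subsetD)
    then have "X' \<times> Y' \<subseteq> T" by blast
    then show False using nb ij snd card slices unfolding no_biclique_def by metis
  next
    assume "\<forall>x\<in>X'. \<forall>y\<in>Y'. f y < f x"
    then have "(y, x) \<in> T" if "x \<in> X'" "y \<in> Y'" for x y
      using tot[of x y] f[of x y] that X'(1) Y'(1) by (meson Diff_iff less_asym subsetD)
    then have "Y' \<times> X' \<subseteq> T" by blast
    then show False using nb ij snd card slices unfolding no_biclique_def by metis
  qed
qed

text \<open>One of the two families of \<open>2 * d\<close> midpoints consists only of vertices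
  adjacent to \<open>(i, a)\<close> or \<open>(i, b)\<close>. If fewer than \<open>d\<close> belong
  to \<open>(i, a)\<close>, at least \<open>d\<close> belong to \<open>(i, b)\<close>.\<close>

lemma low_degree_unique:
  assumes bp: "block_paths k n s (2 * d) T" and len: "2 * d * s \<le> n"
    and ij: "i < k" "j < k" "i \<noteq> j" and ab: "a < n" "b < n" "a \<noteq> b"
    and low: "card {y\<in>{j} \<times> {..<n}. adj (i, a) y} < d"
  shows "card {y\<in>{j} \<times> {..<n}. adj (i, b) y} \<ge> d"
proof -
  have "\<exists>y\<in>{c * s..<c * s + s}. ((i, b), (j, y)) \<in> T \<and> ((j, y), (i, a)) \<in> T" if "c < 2 * d" for c
    using bp that ij ab unfolding block_paths_def by blast
  then obtain y where y: "\<And>c. c < 2 * d \<Longrightarrow> y c \<in> {c * s..<c * s + s}"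
    "\<And>c. c < 2 * d \<Longrightarrow> ((i, b), (j, y c)) \<in> T \<and> ((j, y c), (i, a)) \<in> T" by metis
  have "\<exists>y\<in>{c * s..<c * s + s}. ((i, a), (j, y)) \<in> T \<and> ((j, y), (i, b)) \<in> T" if "c < 2 * d" for c
    using bp that ij ab unfolding block_paths_def by blast
  then obtain z where z: "\<And>c. c < 2 * d \<Longrightarrow> z c \<in> {c * s..<c * s + s}"
    "\<And>c. c < 2 * d \<Longrightarrow> ((i, a), (j, z c)) \<in> T \<and> ((j, z c), (i, b)) \<in> T" by metis
  define ok where "ok w \<longleftrightarrow> (\<forall>c<2 * d. adj (i, a) (j, w c) \<or> adj (i, b) (j, w c))" for w :: "nat \<Rightarrow> nat"
  \<comment> \<open>Otherwise \<open>T - H\<close> contains a 4-cycle through \<open>(i, a)\<close> and \<open>(i, b)\<close>.\<close>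
  have "ok y \<or> ok z"
  proof (rule ccontr)
    assume "\<not> (ok y \<or> ok z)"
    then obtain c c' where c: "c < 2 * d" "\<not> adj (i, a) (j, y c)" "\<not> adj (i, b) (j, y c)"
      and c': "c' < 2 * d" "\<not> adj (i, a) (j, z c')" "\<not> adj (i, b) (j, z c')"
      unfolding ok_def by blast
    have "((i, a), (j, z c')) \<in> T - H" "((j, z c'), (i, b)) \<in> T - H"
      "((i, b), (j, y c)) \<in> T - H" "((j, y c), (i, a)) \<in> T - H"
      using y(2)[OF c(1)] z(2)[OF c'(1)] c c' by (auto simp: adj_def)
    then have "((i, a), (i, a)) \<in> (T - H)\<^sup>+" by (meson r_into_trancl trancl_trans)
    then show False using H by (auto simp: feedback_arc_set_def acyclic_def)
  qed
  then obtain w where w: "ok w" "\<And>c. c < 2 * d \<Longrightarrow> w c \<in> {c * s..<c * s + s}"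
    using y(1) z(1) by blast
  \<comment> \<open>The midpoints come from disjoint blocks.\<close>
  have inj: "inj_on w {..<2 * d}"
  proof (rule inj_onI)
    fix c c' assume c: "c \<in> {..<2 * d}" "c' \<in> {..<2 * d}" and eq: "w c = w c'"
    have r: "w c \<in> {c * s..<c * s + s}" "w c' \<in> {c' * s..<c' * s + s}"
      using w(2)[of c] w(2)[of c'] c by simp_all
    have False if "p < q" "x \<in> {p * s..<p * s + s}" "x \<in> {q * s..<q * s + s}" for p q x
    proof -
      have "Suc p * s \<le> q * s" using that(1) by (intro mult_le_mono1) auto
      then show False using that(2,3) by auto
    qed
    from this[of c c' "w c"] this[of c' c "w c"] show "c = c'"
      using r eq by (cases c c' rule: linorder_cases) simp_all
  qed
  have wn: "w c < n" if "c < 2 * d" for c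
  proof -
    have "Suc c * s \<le> 2 * d * s" using that by (intro mult_le_mono1) auto
    then show ?thesis using w(2)[OF that] len by auto
  qed
  define C where "C v = {c. c < 2 * d \<and> adj v (j, w c)}" for v
  have C_le: "card (C v) \<le> card {y\<in>{j} \<times> {..<n}. adj v y}" for v
  proof (rule card_inj_on_le[where f = "\<lambda>c. (j, w c)"])
    show "inj_on (\<lambda>c. (j, w c)) (C v)" using inj by (auto simp: inj_on_def C_def)
    show "(\<lambda>c. (j, w c)) ` C v \<subseteq> {y\<in>{j} \<times> {..<n}. adj v y}" using wn by (auto simp: C_def)
  qed simp
  have "C (i, a) \<union> C (i, b) = {..<2 * d}" using w(1) by (auto simp: C_def ok_def)
  then have "2 * d \<le> card (C (i, a)) + card (C (i, b))" using card_Un_le by (metis card_lessThan)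
  then show ?thesis using C_le[of "(i, a)"] C_le[of "(i, b)"] low by linarith
qed

text \<open>Deleting \<open>k - 1\<close> vertices per class, the bad ones among them, leaves a
  \<open>dense_multipartite\<close> graph with classes of size \<open>n - k + 1\<close>; its perfect
  tiling provides the cliques.\<close>

lemma disjoint_cliques:
  assumes k: "k \<ge> 2" and s: "s > 0" and nb: "no_biclique k n s T"
    and bp: "block_paths k n s (2 * ((8 * s) ^ 3 ^ k + k)) T"
    and len: "2 * ((8 * s) ^ 3 ^ k + k) * s \<le> n"
  shows "has_disjoint_cliques H k (n - k + 1)"
proof -
  \<comment> \<open>\<open>adj\<close> is dense with parameter \<open>2 * s\<close>, so the tiling
    asks for degree \<open>(4 * (2 * s)) ^ 3 ^ k\<close>; the summand \<open>k\<close> covers the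
    loss of \<open>k - 1\<close> neighbours by deletion.\<close>
  define d where "d = (8 * s) ^ 3 ^ k + k"
  define A where "A i = {i} \<times> {..<n}" for i :: nat
  have finA: "finite (A i)" and cardA: "card (A i) = n" for i by (simp_all add: A_def)
  have "2 * d * 1 \<le> 2 * d * s" using s by (intro mult_le_mono) auto
  then have dn: "d \<le> n" using len unfolding d_def[symmetric] by linarith
  then have kn: "k \<le> n" by (simp add: d_def)
  define L where "L i j = {v\<in>A i. card {y\<in>A j. adj v y} < d}" for i j
  have L1: "card (L i j) \<le> 1" if ij: "i < k" "j < k" "i \<noteq> j" for i j
  proof -
    have "v = v'" if v: "v \<in> L i j" "v' \<in> L i j" for v v'
    proof (rule ccontr)
      assume "v \<noteq> v'"
      moreover obtain a b where "v = (i, a)" "a < n" "v' = (i, b)" "b < n"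
        using v by (auto simp: L_def A_def)
      ultimately show False
        using low_degree_unique[of s d i j a b] bp len ij v by (auto simp: L_def A_def d_def)
    qed
    then show ?thesis by (metis card_le_Suc0_iff_eq One_nat_def card_eq_0_iff le0)
  qed
  \<comment> \<open>At most one vertex of class \<open>i\<close> is bad for each of the
    \<open>k - 1\<close> other classes.\<close>
  define Bad where "Bad i = (\<Union>j\<in>{..<k} - {i}. L i j)" for i
  have Bad: "card (Bad i) \<le> k - 1" if "i < k" for i
  proof -
    have "card (Bad i) \<le> (\<Sum>j\<in>{..<k} - {i}. card (L i j))"
      unfolding Bad_def by (rule card_UN_le) simp
    also have "\<dots> \<le> (\<Sum>j\<in>{..<k} - {i}. 1)" by (intro sum_mono L1) (use that in auto)
    also have "\<dots> = k - 1" using that by simp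
    finally show ?thesis .
  qed
  \<comment> \<open>Exactly \<open>n - (k - 1)\<close> vertices are kept even if fewer are bad, as
    the classes must have equal size.\<close>
  have "\<exists>W. W \<subseteq> A i - Bad i \<and> card W = n - (k - 1)" if "i < k" for i
  proof -
    have "n - (k - 1) \<le> card (A i) - card (Bad i)" using Bad[OF that] cardA by simp
    also have "\<dots> \<le> card (A i - Bad i)"
      by (rule diff_card_le_card_Diff) (use finA in \<open>auto simp: Bad_def L_def\<close>)
    finally show ?thesis by (meson obtain_subset_with_card_n)
  qed
  then obtain V where V: "\<And>i. i < k \<Longrightarrow> V i \<subseteq> A i - Bad i" "\<And>i. i < k \<Longrightarrow> card (V i) = n - (k - 1)"
    by metis
  have finV: "finite (V i)" if "i < k" for i using V(1)[OF that] finA finite_subset by blast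
  interpret dense_multipartite V adj k "n - (k - 1)" "2 * s" "d - (k - 1)"
  proof
    show "\<exists>x\<in>X. \<exists>y\<in>Y. adj x y" if "i < k" "j < k" "i \<noteq> j" "X \<subseteq> V i" "Y \<subseteq> V j"
      "2 * s \<le> card X" "2 * s \<le> card Y" for i j X Y
    proof (rule adj_dense[OF nb s that(1-3) _ _ that(6,7)])
      show "X \<subseteq> {i} \<times> {..<n}" "Y \<subseteq> {j} \<times> {..<n}" using V(1) that(1,2,4,5) by (auto simp: A_def)
    qed
    show "d - (k - 1) \<le> card {y \<in> V j. adj v y}" if "i < k" "j < k" "i \<noteq> j" "v \<in> V i" for i j v
    proof -
      have "v \<in> A i" "v \<notin> L i j" using V(1)[of i] that by (auto simp: Bad_def)
      then have "d \<le> card {y\<in>A j. adj v y}" by (simp add: L_def)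
      also have "\<dots> \<le> card ({y\<in>V j. adj v y} \<union> (A j - V j))"
        by (rule card_mono) (use finV[OF that(2)] finA in auto)
      also have "\<dots> \<le> card {y\<in>V j. adj v y} + card (A j - V j)" by (rule card_Un_le)
      also have "card (A j - V j) = n - (n - (k - 1))"
        using card_Diff_subset[OF finV[OF that(2)], of "A j"] V[OF that(2)] cardA by auto
      finally show ?thesis using kn by linarith
    qed
    show "d - (k - 1) \<le> n - (k - 1)" using dn by simp
    show "(4 * (2 * s)) ^ 3 ^ k \<le> d - (k - 1)" by (simp add: d_def)
  qed (use finV V(2) adj_sym s in auto)
  let ?m = "n - (k - 1)"
  obtain Q where "partial_tiling ?m Q" using perfect_tiling by blast
  then have QV: "\<And>b i. b < ?m \<Longrightarrow> i < k \<Longrightarrow> Q b i \<in> V i"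
    and Qinj: "\<And>i. i < k \<Longrightarrow> inj_on (\<lambda>b. Q b i) {..<?m}"
    and Qadj: "\<And>b i j. b < ?m \<Longrightarrow> i < k \<Longrightarrow> j < k \<Longrightarrow> i \<noteq> j \<Longrightarrow> adj (Q b i) (Q b j)"
    by (auto simp: partial_tiling_def)
  have fstQ: "fst (Q b i) = i" if "b < ?m" "i < k" for b i
    using QV[OF that] V(1)[OF that(2)] by (auto simp: A_def)
  define K where "K b = Q b ` {..<k}" for b
  have disj: "K b \<inter> K c = {}" if "b < ?m" "c < ?m" "b \<noteq> c" for b c
  proof (rule ccontr)
    assume "K b \<inter> K c \<noteq> {}"
    then obtain v where "v \<in> Q b ` {..<k}" "v \<in> Q c ` {..<k}" unfolding K_def by blast
    then obtain i j where ij: "i < k" "j < k" "Q b i = Q c j" by fastforce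
    then have "i = j" using fstQ that by metis
    then show False using Qinj[OF ij(1)] ij that by (auto simp: inj_on_def)
  qed
  \<comment> \<open>Nonempty disjoint sets are distinct, so \<open>K\<close> yields as many cliques
    as there are rows.\<close>
  have "K b \<noteq> {}" for b using k by (simp add: K_def lessThan_empty_iff)
  then have "inj_on K {..<?m}" using disj by (metis Int_absorb inj_onI lessThan_iff)
  then have "card (K ` {..<?m}) = ?m" by (simp add: card_image)
  then have "card (K ` {..<?m}) = n - k + 1" using kn k by simp
  moreover have "is_clique H k (K b)" if b: "b < ?m" for b
  proof -
    have "inj_on (Q b) {..<k}" using fstQ[OF b] by (metis inj_onI lessThan_iff)
    then have "card (K b) = k" by (simp add: K_def card_image)
    moreover have "(u, v) \<in> H \<or> (v, u) \<in> H" if "u \<in> K b" "v \<in> K b" "u \<noteq> v" for u v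
      using Qadj[OF b] that by (auto simp: K_def adj_def)
    ultimately show ?thesis unfolding is_clique_def by (auto simp: K_def)
  qed
  ultimately show ?thesis
    unfolding has_disjoint_cliques_def
    by (intro exI[of _ "K ` {..<?m}"]) (use disj in auto)
qed

end

section \<open>Asymptotics\<close>

text \<open>With \<open>r\<close> the \<open>c\<close>-th root of \<open>q\<close>, the term is the
  \<open>c\<close>-th power of \<open>real (Suc s) * r ^ Suc s\<close>, up to the factor
  \<open>q\<close> caused by the index shift.\<close>

lemma tendsto_power_times_geometric:
  fixes q :: real
  assumes "0 < q" "q < 1" "c > 0"
  shows "(\<lambda>s. real (Suc s) ^ c * q ^ s) \<longlonglongrightarrow> 0"
proof -
  define r where "r = root c q"
  have r: "0 < r" "r < 1" "r ^ c = q" using assms by (simp_all add: r_def real_root_pow_pos)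
  have "(\<lambda>s. real s * r ^ s) \<longlonglongrightarrow> 0"
    using powser_times_n_limit_0[of r] r by simp
  then have "(\<lambda>s. (real (Suc s) * r ^ Suc s) ^ c / q) \<longlonglongrightarrow> 0 ^ c / q"
    using assms by (intro tendsto_divide tendsto_const tendsto_power LIMSEQ_Suc) auto
  moreover have "(real (Suc s) * r ^ Suc s) ^ c / q = real (Suc s) ^ c * q ^ s" for s
  proof -
    have "(r ^ Suc s) ^ c = q ^ Suc s" by (metis r(3) power_mult mult.commute)
    then show ?thesis using assms by (simp add: power_mult_distrib del: of_nat_Suc)
  qed
  moreover have "(0::real) ^ c / q = 0" using assms(3) by simp
  ultimately show ?thesis by simp
qed

lemma multipartite_tournaments_nonempty: "multipartite_tournaments k n \<noteq> {}"
proof -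
  have "{(u, v). u \<in> mp_vertices k n \<and> v \<in> mp_vertices k n \<and> fst u < fst v}
      \<in> multipartite_tournaments k n"
    unfolding multipartite_tournaments_def by auto
  then show ?thesis by blast
qed

text \<open>Outside the two exceptional events \<open>disjoint_cliques\<close> applies. By
  \<open>n \<le> Suc s ^ c\<close> the powers of \<open>n\<close> in the union bounds are polynomial
  in \<open>s\<close>, so the geometric factors dominate.\<close>

lemma good_tournament_fraction_ge:
  assumes k: "k \<ge> 2" and s: "s > 0" and len: "2 * ((8 * s) ^ 3 ^ k + k) * s \<le> n"
    and n: "n \<le> Suc s ^ c" and small: "real (Suc s) ^ (2 * c) * (1 / 2) ^ s \<le> 1"
  shows "real (card {T \<in> multipartite_tournaments k n. good_tournament k n T})
           / real (card (multipartite_tournaments k n))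
    \<ge> 1 - real k ^ 2 * (real (Suc s) ^ (2 * c) * (1 / 2) ^ s + real (Suc s) ^ (3 * c) * (3 / 4) ^ s)"
proof -
  define mt where "mt = multipartite_tournaments k n"
  define r where "r = 2 * ((8 * s) ^ 3 ^ k + k)"
  define good where "good = {T \<in> mt. good_tournament k n T}"
  define b1 where "b1 = {T \<in> mt. \<not> no_biclique k n s T}"
  define b2 where "b2 = {T \<in> mt. \<not> block_paths k n s r T}"
  define x where "x = real (Suc s) ^ (2 * c) * (1 / 2) ^ s"
  have fin: "finite mt" by (simp add: mt_def finite_multipartite_tournaments)
  have pos: "real (card mt) > 0"
    using fin multipartite_tournaments_nonempty by (simp add: mt_def card_gt_0_iff)
  have "mt \<subseteq> good \<union> b1 \<union> b2"
  proof
    fix T assume T: "T \<in> mt"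
    have "has_disjoint_cliques H k (n - k + 1)"
      if "no_biclique k n s T" "block_paths k n s r T" "minimal_feedback_arc_set T H" for H
    proof -
      interpret tournament_fas k n T H
      proof
        show "T \<in> multipartite_tournaments k n" using T by (simp add: mt_def)
        show "feedback_arc_set T H" using that(3) unfolding minimal_feedback_arc_set_def by blast
      qed
      show ?thesis using disjoint_cliques[OF k s that(1)] that(2) len by (simp add: r_def)
    qed
    then show "T \<in> good \<union> b1 \<union> b2"
      using T by (auto simp: good_def b1_def b2_def good_tournament_def)
  qed
  then have "card mt \<le> card (good \<union> b1 \<union> b2)"
    by (rule card_mono[rotated]) (use fin in \<open>auto simp: good_def b1_def b2_def\<close>)
  also have "\<dots> \<le> card good + card b1 + card b2"
    by (meson card_Un_le add_le_mono1 order_trans)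
  finally have "real (card mt) \<le> real (card good) + real (card b1) + real (card b2)" by linarith
  moreover have "real (card b1) \<le> real k ^ 2 * x * real (card mt)"
  proof -
    have "real n ^ (2 * s) / 2 ^ (s * s) = (real n ^ 2 / 2 ^ s) ^ s"
      by (simp only: power_mult power_divide)
    also have "\<dots> = (real n ^ 2 * (1 / 2) ^ s) ^ s" by (simp add: power_one_over)
    also have "\<dots> \<le> x ^ s"
    proof (rule power_mono)
      have "real n ^ 2 \<le> (real (Suc s) ^ c) ^ 2"
        using n by (intro power_mono) (metis of_nat_le_iff of_nat_power, simp)
      then show "real n ^ 2 * (1 / 2) ^ s \<le> x"
        unfolding x_def by (intro mult_right_mono) (simp_all add: power_mult[symmetric] mult.commute)
    qed simp
    \<comment> \<open>By \<open>small\<close>, \<open>x\<close> is at most 1, so its first power is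
      the larger one.\<close>
    also have "\<dots> \<le> x ^ 1"
      by (rule power_decreasing) (use s small in \<open>auto simp: x_def\<close>)
    finally have "real n ^ (2 * s) / 2 ^ (s * s) \<le> x" by simp
    then have "real k ^ 2 * (real n ^ (2 * s) / 2 ^ (s * s)) * real (card mt) \<le> real k ^ 2 * x * real (card mt)"
      by (intro mult_right_mono mult_left_mono) auto
    then show ?thesis using card_not_no_biclique[of k n s] by (simp add: b1_def mt_def)
  qed
  moreover have "real (card b2) \<le> real k ^ 2 * (real (Suc s) ^ (3 * c) * (3 / 4) ^ s) * real (card mt)"
  proof -
    have "r * 1 \<le> r * s" using s by (intro mult_le_mono) auto
    then have rn: "r \<le> n" using len unfolding r_def[symmetric] by linarith
    \<comment> \<open>The number of blocks is bounded crudely by \<open>n\<close>, which accounts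
      for the exponent \<open>3 * c\<close>.\<close>
    have "real n ^ 2 * real r \<le> real n ^ 2 * real n" using rn by (intro mult_left_mono) auto
    also have "\<dots> = real n ^ 3" by (simp add: power3_eq_cube power2_eq_square)
    also have "\<dots> \<le> (real (Suc s) ^ c) ^ 3"
      using n by (intro power_mono) (metis of_nat_le_iff of_nat_power, simp)
    also have "\<dots> = real (Suc s) ^ (3 * c)" by (simp add: power_mult[symmetric] mult.commute)
    finally have "real k ^ 2 * (real n ^ 2 * real r * (3 / 4) ^ s) * real (card mt)
        \<le> real k ^ 2 * (real (Suc s) ^ (3 * c) * (3 / 4) ^ s) * real (card mt)"
      by (intro mult_right_mono mult_left_mono) auto
    then show ?thesis
      using card_not_block_paths[of r s n k] len unfolding r_def[symmetric]
      by (simp add: b2_def mt_def mult.assoc)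
  qed
  ultimately have "(1 - real k ^ 2 * (x + real (Suc s) ^ (3 * c) * (3 / 4) ^ s)) * real (card mt)
      \<le> real (card good)"
    by (simp add: algebra_simps)
  then have "1 - real k ^ 2 * (x + real (Suc s) ^ (3 * c) * (3 / 4) ^ s) \<le> real (card good) / real (card mt)"
    using pos by (simp add: pos_le_divide_eq)
  then show ?thesis by (simp only: x_def good_def mt_def)
qed

theorem theorem2p1:
  fixes k :: nat
  assumes "k \<ge> 2"
  shows "(\<lambda>n. real (card {T \<in> multipartite_tournaments k n. good_tournament k n T})
              / real (card (multipartite_tournaments k n))) \<longlonglongrightarrow> 1"
proof -
  define M :: nat where "M = 3 ^ k"
  \<comment> \<open>The blocks need \<open>2 * ((8 * s) ^ M + k) * s\<close> positions, which has
    degree \<open>M + 1\<close> in \<open>s\<close>; two further factors \<open>s\<close> absorb the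
    constants. So \<open>s\<close> is taken as the integer part of the \<open>c\<close>-th root of
    \<open>n\<close>.\<close>
  define c where "c = M + 3"
  define s where "s n = nat \<lfloor>root c (real n)\<rfloor>" for n
  have c: "c > 0" by (simp add: c_def)
  have s_eq: "real (s n) = of_int \<lfloor>root c (real n)\<rfloor>" for n
    using real_root_ge_zero[of "real n" c] by (simp add: s_def)
  have s_le: "s n ^ c \<le> n" for n
  proof -
    have "real (s n) \<le> root c (real n)" unfolding s_eq by simp
    then have "real (s n) ^ c \<le> root c (real n) ^ c" by (intro power_mono) auto
    also have "\<dots> = real n" using c by simp
    finally show ?thesis by (metis of_nat_le_iff of_nat_power)
  qed
  have less_s: "n \<le> Suc (s n) ^ c" for n
  proof -
    have "root c (real n) \<le> real (Suc (s n))"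
      using s_eq[of n] real_of_int_floor_add_one_ge[of "root c (real n)"] unfolding of_nat_Suc by linarith
    then have "root c (real n) ^ c \<le> real (Suc (s n)) ^ c"
      by (intro power_mono) (simp_all add: real_root_ge_zero)
    moreover have "root c (real n) ^ c = real n" using c by simp
    ultimately show ?thesis by (metis of_nat_le_iff of_nat_power)
  qed
  have s_lim: "filterlim s at_top sequentially"
    unfolding filterlim_at_top
  proof
    fix N
    have "N \<le> s n" if "n \<ge> N ^ c" for n
    proof (rule ccontr)
      assume "\<not> N \<le> s n"
      then have "Suc (s n) ^ c \<le> N ^ c" by (intro power_mono) auto
      \<comment> \<open>In this boundary case the root is exactly \<open>N\<close>, so
        \<open>s n = N\<close> after all.\<close>
      then have eq: "n = N ^ c" using that less_s[of n] by linarith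
      then have "root c (real n) = real N" using c by (simp add: real_root_power_cancel)
      then show False using \<open>\<not> N \<le> s n\<close> by (simp add: s_def)
    qed
    then show "\<forall>\<^sub>F n in sequentially. N \<le> s n" by (rule eventually_sequentiallyI)
  qed
  define g1 where "g1 s = real (Suc s) ^ (2 * c) * (1 / 2) ^ s" for s
  define g2 where "g2 s = real (Suc s) ^ (3 * c) * (3 / 4) ^ s" for s
  have g1: "g1 \<longlonglongrightarrow> 0" and g2: "g2 \<longlonglongrightarrow> 0"
    unfolding g1_def g2_def by (rule tendsto_power_times_geometric; use c in simp)+
  have "\<forall>\<^sub>F x in sequentially. g1 x < 1" using g1 by (rule order_tendstoD) simp
  then have small: "\<forall>\<^sub>F n in sequentially. g1 (s n) < 1" using s_lim by (rule eventually_compose_filterlim)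
  have large: "\<forall>\<^sub>F n in sequentially. s n \<ge> 2 * 8 ^ M + 2 * k"
    using s_lim by (simp add: filterlim_at_top)
  have "\<forall>\<^sub>F n in sequentially. 1 - real k ^ 2 * (g1 (s n) + g2 (s n))
      \<le> real (card {T \<in> multipartite_tournaments k n. good_tournament k n T})
              / real (card (multipartite_tournaments k n))"
    using small large
  proof eventually_elim
    case (elim n)
    let ?s = "s n"
    have s: "?s > 0" "?s \<ge> 2" "2 * 8 ^ M \<le> ?s" "2 * k \<le> ?s" using elim(2) assms by auto
    have "2 * ((8 * ?s) ^ M + k) * ?s = (2 * 8 ^ M) * (?s ^ M * ?s) + (2 * k) * ?s"
      by (simp add: power_mult_distrib algebra_simps)
    \<comment> \<open>One factor \<open>?s\<close> absorbs the constants \<open>2 * 8 ^ M\<close>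
      and \<open>2 * k\<close>; a second one absorbs the 2 that arises from adding the
      terms.\<close>
    also have "\<dots> \<le> ?s * (?s ^ M * ?s) + ?s * (?s ^ M * ?s)"
    proof (intro add_mono mult_mono)
      show "?s \<le> ?s ^ M * ?s" using s(1) by simp
    qed (use s in auto)
    also have "\<dots> = 2 * (?s ^ M * ?s ^ 2)" by (simp add: power2_eq_square algebra_simps)
    also have "\<dots> \<le> ?s * (?s ^ M * ?s ^ 2)" using s(2) by (rule mult_le_mono1)
    also have "\<dots> = ?s ^ c" by (simp add: c_def power_add power2_eq_square power3_eq_cube)
    also have "\<dots> \<le> n" by (rule s_le)
    finally have "2 * ((8 * ?s) ^ 3 ^ k + k) * ?s \<le> n" by (simp add: M_def)
    then show ?case
      using good_tournament_fraction_ge[OF assms s(1) _ less_s] elim(1) by (simp add: g1_def g2_def)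
  qed
  moreover have "\<forall>\<^sub>F n in sequentially.
      real (card {T \<in> multipartite_tournaments k n. good_tournament k n T})
              / real (card (multipartite_tournaments k n)) \<le> 1"
    by (intro always_eventually allI divide_le_eq_1_pos[THEN iffD2] of_nat_mono card_mono)
      (auto simp: finite_multipartite_tournaments multipartite_tournaments_nonempty card_gt_0_iff)
  moreover have "(\<lambda>n. 1 - real k ^ 2 * (g1 (s n) + g2 (s n))) \<longlonglongrightarrow> 1"
  proof -
    have "(\<lambda>n. 1 - real k ^ 2 * (g1 (s n) + g2 (s n))) \<longlonglongrightarrow> 1 - real k ^ 2 * (0 + 0)"
      by (intro tendsto_intros filterlim_compose[OF g1 s_lim] filterlim_compose[OF g2 s_lim])
    then show ?thesis by simp
  qed
  ultimately show ?thesis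
    by (rule tendsto_sandwich[OF _ _ _ tendsto_const])
qed

end
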